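(* Let $\mathcal{C}$ be a unitary multitensor category with $\dim(\mathcal{C}(1_{\mathcal{C}}\to 1_{\mathcal{C}}))=r$ which is faithfully graded by $\mathcal{M}_r$, the groupoid with $r$ objects and exactly one isomorphism between any two objects. For each groupoid homomorphism $\pi\in\mathrm{Hom}(\mathcal{M}_r\to\mathbb{R}_{>0})$ there exists a unique faithful state $\psi^\pi:\mathcal{C}(1_{\mathcal{C}}\to 1_{\mathcal{C}})\to\mathbb{C}$ such that for all $c\in\mathcal{C}$ and $f\in\mathcal{C}(c\to c)$, $$\psi^\pi(\mathrm{tr}^\pi_L(f))=\psi^\pi(\mathrm{tr}^\pi_R(f)).$$
   Context: Unitary multitensor category: a semisimple, locally finite $\mathbb{C}$-linear abelian rigid monoidal category $\mathcal{C}$ with bilinear $\otimes$ ($1_{\mathcal C}$ not necessarily simple), equipped with a dagger structure (antilinear maps $\dagger:\mathcal{C}(a\to b)\to\mathcal{C}(b\to a)$, $f^{\dagger\dagger}=f$, $(f\circ g)^\dagger=g^\dagger\circ f^\dagger$, $(f\otimes g)^\dagger=f^\dagger\otimes g^\dagger$) such that associators and unitors are unitary, endomorphism algebras are $C^*$-algebras, and $\mathcal{C}$ has orthogonal direct sums and is idempotent complete. $\mathbb{R}_{>0}$ is viewed as a groupoid with one object. A grading of $\mathcal{C}$ by a groupoid $\mathcal{G}$ (identified with its set of morphisms) is a decomposition $\mathcal{C}=\bigoplus_{g\in\mathcal{G}}\mathcal{C}_g$ into semisimple $C^*$ subcategories such that $\otimes$ maps $\mathcal{C}_g\times\mathcal{C}_h$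 to $\mathcal{C}_{gh}$ if $g,h$ are composable and is zero otherwise; faithful means every $\mathcal{C}_g\neq0$. The morphisms of $\mathcal{M}_r$ are identified with matrix units $E_{ij}$, $1\le i,j\le r$, with $E_{ij}E_{jk}=E_{ik}$. Dual functor $\vee$: a choice, for each $c$, of a dual $(c^\vee,\mathrm{ev}_c:c^\vee\otimes c\to 1,\mathrm{coev}_c:1\to c\otimes c^\vee)$ satisfying the zig-zag axioms, with $f^\vee=(\mathrm{ev}_b\otimes\mathrm{id}_{a^\vee})\circ(\mathrm{id}_{b^\vee}\otimes f\otimes\mathrm{id}_{a^\vee})\circ(\mathrm{id}_{b^\vee}\otimes\mathrm{coev}_a)$ for $f\in\mathcal{C}(a\to b)$ and canonical tensorator $\nu_{a,b}=(\mathrm{ev}_b\otimes \mathrm{id})\circ(\mathrm{id}_{b^\vee}\otimes\mathrm{ev}_a\otimes\mathrm{id}_b\otimes\mathrm{id})\circ(\mathrm{id}_{b^\vee\otimes a^\vee}\otimes\mathrm{coev}_{a\otimes b}): b^\vee\otimes a^\vee\to(a\otimes b)^\vee$; it is unitary if $f^{\vee\dagger}=f^{\dagger\vee}$ for all $f$ and all $\nu_{a,b}$ are unitary. Let $\Psi:\mathcal{C}(1\to1)\to\mathbb{C}$ be the linear functional sending each minimal projection to $1$. For $\pi\in\mathrm{Hom}(\mathcal{M}_r\to\mathbb{R}_{>0})$, there is a $\pi$-balanced unitary dual functor $\vee_\pi$, unique up to unique unitary monoidal natural isomorphism: its duals $(c^{\vee_\pi},\mathrm{ev}^\pi_c,\mathrm{coev}^\pi_c)$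 satisfy $\Psi(\mathrm{ev}^\pi_c\circ(\mathrm{id}\otimes f_g)\circ(\mathrm{ev}^\pi_c)^\dagger)=\pi(g)\,\Psi((\mathrm{coev}^\pi_c)^\dagger\circ(f_g\otimes\mathrm{id})\circ\mathrm{coev}^\pi_c)$ for all $c$, $f\in\mathcal{C}(c\to c)$ and $g\in\mathcal{M}_r$, where $f_g$ is the $g$-graded component of $f$. The associated traces $\mathcal{C}(c\to c)\to\mathcal{C}(1\to1)$ are $\mathrm{tr}^\pi_L(f)=\mathrm{ev}^\pi_c\circ(\mathrm{id}_{c^{\vee_\pi}}\otimes f)\circ(\mathrm{ev}^\pi_c)^\dagger$ and $\mathrm{tr}^\pi_R(f)=(\mathrm{coev}^\pi_c)^\dagger\circ(f\otimes\mathrm{id}_{c^{\vee_\pi}})\circ\mathrm{coev}^\pi_c$. A faithful state on $\mathcal{C}(1_{\mathcal C}\to1_{\mathcal C})\cong\mathbb{C}^r$ is a linear functional $\psi$ with $\psi(\mathrm{id}_{1_{\mathcal C}})=1$ and $\psi(p)>0$ for every nonzero idempotent $p$. *)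

theory Defs
  imports Complex_Main "HOL-Library.FuncSet"
begin

section \<open>Unitary multitensor categories\<close>

text \<open>
  The data of a (small) C-linear monoidal dagger category.  All morphisms live in one ambient
  complex vector space \<open>'m\<close> (think of the direct sum of all hom-spaces), and every \<open>Hom a b\<close>
  is a linear subspace of it; nothing is assumed about the operations outside of the hom-spaces.
  In this way addition, finite sums, spans and dimensions are those of the library.
  \<open>Assoc a b c : (a \<odot> b) \<odot> c \<rightarrow> a \<odot> (b \<odot> c)\<close>, \<open>LUnit a : \<one> \<odot> a \<rightarrow> a\<close> and
  \<open>RUnit a : a \<odot> \<one> \<rightarrow> a\<close>.
\<close>

record ('o, 'm) mcat =
  Obj   :: "'o set"
  Hom   :: "'o \<Rightarrow> 'o \<Rightarrow> 'm set"
  Id    :: "'o \<Rightarrow> 'm"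
  comp  :: "'m \<Rightarrow> 'm \<Rightarrow> 'm"            (infixl "\<cdot>\<index>" 70)
  scal  :: "complex \<Rightarrow> 'm \<Rightarrow> 'm"
  tunit :: "'o"                         ("\<one>\<index>")
  otens :: "'o \<Rightarrow> 'o \<Rightarrow> 'o"            (infixr "\<odot>\<index>" 75)
  mtens :: "'m \<Rightarrow> 'm \<Rightarrow> 'm"            (infixr "\<otimes>\<index>" 75)
  Assoc :: "'o \<Rightarrow> 'o \<Rightarrow> 'o \<Rightarrow> 'm"
  LUnit :: "'o \<Rightarrow> 'm"
  RUnit :: "'o \<Rightarrow> 'm"
  dag   :: "'m \<Rightarrow> 'm"                  ("(_\<^sup>\<dagger>\<index>)" [1000] 999)


subsection \<open>Linear, abelian, semisimple and locally finite categories\<close>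

locale linear_category = vector_space "scal C"
  for C :: "('o, 'm::ab_group_add) mcat" (structure) +
  assumes hom_subspace: "\<lbrakk>a \<in> Obj C; b \<in> Obj C\<rbrakk> \<Longrightarrow> subspace (Hom C a b)"
    and id_hom: "a \<in> Obj C \<Longrightarrow> Id C a \<in> Hom C a a"
    and comp_hom: "\<lbrakk>a \<in> Obj C; b \<in> Obj C; c \<in> Obj C; g \<in> Hom C b c; f \<in> Hom C a b\<rbrakk>
          \<Longrightarrow> g \<cdot> f \<in> Hom C a c"
    and comp_id_left: "\<lbrakk>a \<in> Obj C; b \<in> Obj C; f \<in> Hom C a b\<rbrakk> \<Longrightarrow> Id C b \<cdot> f = f"
    and comp_id_right: "\<lbrakk>a \<in> Obj C; b \<in> Obj C; f \<in> Hom C a b\<rbrakk> \<Longrightarrow> f \<cdot> Id C a = f"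
    and comp_assoc: "\<lbrakk>a \<in> Obj C; b \<in> Obj C; c \<in> Obj C; d \<in> Obj C;
          h \<in> Hom C c d; g \<in> Hom C b c; f \<in> Hom C a b\<rbrakk> \<Longrightarrow> (h \<cdot> g) \<cdot> f = h \<cdot> (g \<cdot> f)"
    and comp_add_left: "\<lbrakk>a \<in> Obj C; b \<in> Obj C; c \<in> Obj C;
          g \<in> Hom C b c; g' \<in> Hom C b c; f \<in> Hom C a b\<rbrakk> \<Longrightarrow> (g + g') \<cdot> f = g \<cdot> f + g' \<cdot> f"
    and comp_add_right: "\<lbrakk>a \<in> Obj C; b \<in> Obj C; c \<in> Obj C;
          g \<in> Hom C b c; f \<in> Hom C a b; f' \<in> Hom C a b\<rbrakk> \<Longrightarrow> g \<cdot> (f + f') = g \<cdot> f + g \<cdot> f'"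
    and comp_scal_left: "\<lbrakk>a \<in> Obj C; b \<in> Obj C; c \<in> Obj C; g \<in> Hom C b c; f \<in> Hom C a b\<rbrakk>
          \<Longrightarrow> scal C z g \<cdot> f = scal C z (g \<cdot> f)"
    and comp_scal_right: "\<lbrakk>a \<in> Obj C; b \<in> Obj C; c \<in> Obj C; g \<in> Hom C b c; f \<in> Hom C a b\<rbrakk>
          \<Longrightarrow> g \<cdot> scal C z f = scal C z (g \<cdot> f)"

definition is_zero_obj :: "('o, 'm::ab_group_add) mcat \<Rightarrow> 'o \<Rightarrow> bool" where
  "is_zero_obj C z \<longleftrightarrow> z \<in> Obj C \<and> (\<forall>a\<in>Obj C. Hom C z a = {0} \<and> Hom C a z = {0})"

definition is_iso :: "('o, 'm) mcat \<Rightarrow> 'o \<Rightarrow> 'o \<Rightarrow> 'm \<Rightarrow> bool" where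
  "is_iso C a b f \<longleftrightarrow> f \<in> Hom C a b \<and> (\<exists>g\<in>Hom C b a. g \<cdot> f = Id C a \<and> f \<cdot> g = Id C b)"
  for C (structure)

definition is_mono :: "('o, 'm) mcat \<Rightarrow> 'o \<Rightarrow> 'o \<Rightarrow> 'm \<Rightarrow> bool" where
  "is_mono C a b m \<longleftrightarrow> m \<in> Hom C a b \<and>
     (\<forall>x\<in>Obj C. \<forall>g\<in>Hom C x a. \<forall>h\<in>Hom C x a. m \<cdot> g = m \<cdot> h \<longrightarrow> g = h)"
  for C (structure)

definition is_epi :: "('o, 'm) mcat \<Rightarrow> 'o \<Rightarrow> 'o \<Rightarrow> 'm \<Rightarrow> bool" where
  "is_epi C a b e \<longleftrightarrow> e \<in> Hom C a b \<and>
     (\<forall>x\<in>Obj C. \<forall>g\<in>Hom C b x. \<forall>h\<in>Hom C b x. g \<cdot> e = h \<cdot> e \<longrightarrow> g = h)"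
  for C (structure)

text \<open>\<open>k : x \<rightarrow> a\<close> is a kernel, respectively \<open>q : b \<rightarrow> x\<close> is a cokernel, of \<open>f : a \<rightarrow> b\<close>.\<close>

definition is_kernel ::
  "('o, 'm::ab_group_add) mcat \<Rightarrow> 'o \<Rightarrow> 'o \<Rightarrow> 'm \<Rightarrow> 'o \<Rightarrow> 'm \<Rightarrow> bool" where
  "is_kernel C a b f x k \<longleftrightarrow> k \<in> Hom C x a \<and> f \<cdot> k = 0 \<and>
     (\<forall>y\<in>Obj C. \<forall>h\<in>Hom C y a. f \<cdot> h = 0 \<longrightarrow> (\<exists>!u. u \<in> Hom C y x \<and> k \<cdot> u = h))"
  for C (structure)

definition is_cokernel ::
  "('o, 'm::ab_group_add) mcat \<Rightarrow> 'o \<Rightarrow> 'o \<Rightarrow> 'm \<Rightarrow> 'o \<Rightarrow> 'm \<Rightarrow> bool" where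
  "is_cokernel C a b f x q \<longleftrightarrow> q \<in> Hom C b x \<and> q \<cdot> f = 0 \<and>
     (\<forall>y\<in>Obj C. \<forall>h\<in>Hom C b y. h \<cdot> f = 0 \<longrightarrow> (\<exists>!u. u \<in> Hom C x y \<and> u \<cdot> q = h))"
  for C (structure)

definition is_biproduct ::
  "('o, 'm::ab_group_add) mcat \<Rightarrow> 'o \<Rightarrow> 'o \<Rightarrow> 'o \<Rightarrow> 'm \<Rightarrow> 'm \<Rightarrow> 'm \<Rightarrow> 'm \<Rightarrow> bool" where
  "is_biproduct C a b c i j p q \<longleftrightarrow>
     i \<in> Hom C a c \<and> j \<in> Hom C b c \<and> p \<in> Hom C c a \<and> q \<in> Hom C c b \<and>
     p \<cdot> i = Id C a \<and> q \<cdot> j = Id C b \<and> p \<cdot> j = 0 \<and> q \<cdot> i = 0 \<and> i \<cdot> p + j \<cdot> q = Id C c"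
  for C (structure)

locale abelian_category = linear_category C
  for C :: "('o, 'm::ab_group_add) mcat" (structure) +
  assumes zero_obj_exists: "\<exists>z. is_zero_obj C z"
    and biproduct_exists: "\<lbrakk>a \<in> Obj C; b \<in> Obj C\<rbrakk>
          \<Longrightarrow> \<exists>c\<in>Obj C. \<exists>i j p q. is_biproduct C a b c i j p q"
    and kernel_exists: "\<lbrakk>a \<in> Obj C; b \<in> Obj C; f \<in> Hom C a b\<rbrakk>
          \<Longrightarrow> \<exists>x\<in>Obj C. \<exists>k. is_kernel C a b f x k"
    and cokernel_exists: "\<lbrakk>a \<in> Obj C; b \<in> Obj C; f \<in> Hom C a b\<rbrakk>
          \<Longrightarrow> \<exists>x\<in>Obj C. \<exists>q. is_cokernel C a b f x q"
    and mono_is_kernel: "\<lbrakk>x \<in> Obj C; a \<in> Obj C; is_mono C x a m\<rbrakk>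
          \<Longrightarrow> \<exists>b\<in>Obj C. \<exists>f\<in>Hom C a b. is_kernel C a b f x m"
    and epi_is_cokernel: "\<lbrakk>b \<in> Obj C; x \<in> Obj C; is_epi C b x e\<rbrakk>
          \<Longrightarrow> \<exists>a\<in>Obj C. \<exists>f\<in>Hom C a b. is_cokernel C a b f x e"

definition is_simple :: "('o, 'm::ab_group_add) mcat \<Rightarrow> 'o \<Rightarrow> bool" where
  "is_simple C x \<longleftrightarrow> x \<in> Obj C \<and> \<not> is_zero_obj C x \<and>
     (\<forall>y\<in>Obj C. \<forall>m. is_mono C y x m \<longrightarrow> is_zero_obj C y \<or> is_iso C y x m)"

inductive finite_length :: "('o, 'm::ab_group_add) mcat \<Rightarrow> 'o \<Rightarrow> bool"
  for C where
  zero: "is_zero_obj C z \<Longrightarrow> finite_length C z"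
| extend: "\<lbrakk>finite_length C y; x \<in> Obj C; is_mono C y x m; is_cokernel C y x m s q;
     is_simple C s\<rbrakk> \<Longrightarrow> finite_length C x"

locale semisimple_category = abelian_category C
  for C :: "('o, 'm::ab_group_add) mcat" (structure) +
  assumes semisimple: "c \<in> Obj C \<Longrightarrow> \<exists>(n::nat) x i p.
     (\<forall>k<n. is_simple C (x k) \<and> i k \<in> Hom C (x k) c \<and> p k \<in> Hom C c (x k)) \<and>
     (\<forall>k<n. \<forall>l<n. p k \<cdot> i l = (if k = l then Id C (x k) else 0)) \<and>
     (\<Sum>k<n. i k \<cdot> p k) = Id C c"

locale locally_finite_category = linear_category C
  for C :: "('o, 'm::ab_group_add) mcat" (structure) +
  assumes hom_finite_dim: "\<lbrakk>a \<in> Obj C; b \<in> Obj C\<rbrakk> \<Longrightarrow> \<exists>B. finite B \<and> Hom C a b = span B"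
    and finite_length: "a \<in> Obj C \<Longrightarrow> finite_length C a"


subsection \<open>Monoidal structure and duals\<close>

locale linear_monoidal_category = linear_category C
  for C :: "('o, 'm::ab_group_add) mcat" (structure) +
  assumes unit_obj: "\<one> \<in> Obj C"
    and tens_obj: "\<lbrakk>a \<in> Obj C; b \<in> Obj C\<rbrakk> \<Longrightarrow> a \<odot> b \<in> Obj C"
    and tens_hom: "\<lbrakk>a \<in> Obj C; b \<in> Obj C; c \<in> Obj C; d \<in> Obj C; f \<in> Hom C a b; g \<in> Hom C c d\<rbrakk>
          \<Longrightarrow> f \<otimes> g \<in> Hom C (a \<odot> c) (b \<odot> d)"
    and tens_id: "\<lbrakk>a \<in> Obj C; b \<in> Obj C\<rbrakk> \<Longrightarrow> Id C a \<otimes> Id C b = Id C (a \<odot> b)"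
    and tens_comp: "\<lbrakk>a \<in> Obj C; b \<in> Obj C; c \<in> Obj C; a' \<in> Obj C; b' \<in> Obj C; c' \<in> Obj C;
          f \<in> Hom C a b; g \<in> Hom C b c; f' \<in> Hom C a' b'; g' \<in> Hom C b' c'\<rbrakk>
          \<Longrightarrow> (g \<cdot> f) \<otimes> (g' \<cdot> f') = (g \<otimes> g') \<cdot> (f \<otimes> f')"
    and tens_add_left: "\<lbrakk>a \<in> Obj C; b \<in> Obj C; c \<in> Obj C; d \<in> Obj C;
          f \<in> Hom C a b; f' \<in> Hom C a b; g \<in> Hom C c d\<rbrakk> \<Longrightarrow> (f + f') \<otimes> g = f \<otimes> g + f' \<otimes> g"
    and tens_add_right: "\<lbrakk>a \<in> Obj C; b \<in> Obj C; c \<in> Obj C; d \<in> Obj C;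
          f \<in> Hom C a b; g \<in> Hom C c d; g' \<in> Hom C c d\<rbrakk> \<Longrightarrow> f \<otimes> (g + g') = f \<otimes> g + f \<otimes> g'"
    and tens_scal_left: "\<lbrakk>a \<in> Obj C; b \<in> Obj C; c \<in> Obj C; d \<in> Obj C;
          f \<in> Hom C a b; g \<in> Hom C c d\<rbrakk> \<Longrightarrow> scal C z f \<otimes> g = scal C z (f \<otimes> g)"
    and tens_scal_right: "\<lbrakk>a \<in> Obj C; b \<in> Obj C; c \<in> Obj C; d \<in> Obj C;
          f \<in> Hom C a b; g \<in> Hom C c d\<rbrakk> \<Longrightarrow> f \<otimes> scal C z g = scal C z (f \<otimes> g)"
    and assoc_iso: "\<lbrakk>a \<in> Obj C; b \<in> Obj C; c \<in> Obj C\<rbrakk>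
          \<Longrightarrow> is_iso C ((a \<odot> b) \<odot> c) (a \<odot> (b \<odot> c)) (Assoc C a b c)"
    and lunit_iso: "a \<in> Obj C \<Longrightarrow> is_iso C (\<one> \<odot> a) a (LUnit C a)"
    and runit_iso: "a \<in> Obj C \<Longrightarrow> is_iso C (a \<odot> \<one>) a (RUnit C a)"
    and assoc_natural: "\<lbrakk>a \<in> Obj C; b \<in> Obj C; c \<in> Obj C; a' \<in> Obj C; b' \<in> Obj C; c' \<in> Obj C;
          f \<in> Hom C a a'; g \<in> Hom C b b'; h \<in> Hom C c c'\<rbrakk>
          \<Longrightarrow> Assoc C a' b' c' \<cdot> ((f \<otimes> g) \<otimes> h) = (f \<otimes> (g \<otimes> h)) \<cdot> Assoc C a b c"
    and lunit_natural: "\<lbrakk>a \<in> Obj C; b \<in> Obj C; f \<in> Hom C a b\<rbrakk>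
          \<Longrightarrow> LUnit C b \<cdot> (Id C \<one> \<otimes> f) = f \<cdot> LUnit C a"
    and runit_natural: "\<lbrakk>a \<in> Obj C; b \<in> Obj C; f \<in> Hom C a b\<rbrakk>
          \<Longrightarrow> RUnit C b \<cdot> (f \<otimes> Id C \<one>) = f \<cdot> RUnit C a"
    and pentagon: "\<lbrakk>a \<in> Obj C; b \<in> Obj C; c \<in> Obj C; d \<in> Obj C\<rbrakk>
          \<Longrightarrow> (Id C a \<otimes> Assoc C b c d) \<cdot> Assoc C a (b \<odot> c) d \<cdot> (Assoc C a b c \<otimes> Id C d)
              = Assoc C a b (c \<odot> d) \<cdot> Assoc C (a \<odot> b) c d"
    and triangle: "\<lbrakk>a \<in> Obj C; b \<in> Obj C\<rbrakk>
          \<Longrightarrow> (Id C a \<otimes> LUnit C b) \<cdot> Assoc C a \<one> b = RUnit C a \<otimes> Id C b"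

text \<open>
  \<open>(d, e, k)\<close> is a dual of \<open>c\<close>, with \<open>e : d \<odot> c \<rightarrow> \<one>\<close> and \<open>k : \<one> \<rightarrow> c \<odot> d\<close>.
  Here and below associators and unitors are inserted explicitly; as they are assumed to be
  unitary, their inverses are written as adjoints.
\<close>

definition is_dual :: "('o, 'm) mcat \<Rightarrow> 'o \<Rightarrow> 'o \<Rightarrow> 'm \<Rightarrow> 'm \<Rightarrow> bool" where
  "is_dual C c d e k \<longleftrightarrow> d \<in> Obj C \<and> e \<in> Hom C (d \<odot> c) \<one> \<and> k \<in> Hom C \<one> (c \<odot> d) \<and>
     RUnit C c \<cdot> (Id C c \<otimes> e) \<cdot> Assoc C c d c \<cdot> (k \<otimes> Id C c) \<cdot> (LUnit C c)\<^sup>\<dagger> = Id C c \<and>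
     LUnit C d \<cdot> (e \<otimes> Id C d) \<cdot> (Assoc C d c d)\<^sup>\<dagger> \<cdot> (Id C d \<otimes> k) \<cdot> (RUnit C d)\<^sup>\<dagger> = Id C d"
  for C (structure)


subsection \<open>Dagger structure\<close>

text \<open>Some complete norm turns the endomorphism algebra of \<open>a\<close> into a C*-algebra.\<close>

definition cstar_endomorphisms :: "('o, 'm::ab_group_add) mcat \<Rightarrow> 'o \<Rightarrow> bool" where
  "cstar_endomorphisms C a \<longleftrightarrow> (\<exists>N :: 'm \<Rightarrow> real.
     (\<forall>f\<in>Hom C a a. 0 \<le> N f \<and> (N f = 0 \<longleftrightarrow> f = 0)) \<and>
     (\<forall>z. \<forall>f\<in>Hom C a a. N (scal C z f) = cmod z * N f) \<and>
     (\<forall>f\<in>Hom C a a. \<forall>g\<in>Hom C a a. N (f + g) \<le> N f + N g) \<and>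
     (\<forall>f\<in>Hom C a a. \<forall>g\<in>Hom C a a. N (f \<cdot> g) \<le> N f * N g) \<and>
     (\<forall>f\<in>Hom C a a. N (f\<^sup>\<dagger> \<cdot> f) = (N f)\<^sup>2) \<and>
     (\<forall>X :: nat \<Rightarrow> 'm. (\<forall>n. X n \<in> Hom C a a) \<longrightarrow>
        (\<forall>\<epsilon>>0. \<exists>K. \<forall>m\<ge>K. \<forall>n\<ge>K. N (X m - X n) < \<epsilon>) \<longrightarrow>
        (\<exists>L\<in>Hom C a a. (\<lambda>n. N (X n - L)) \<longlonglongrightarrow> 0)))"
  for C (structure)

definition is_orth_sum ::
  "('o, 'm::ab_group_add) mcat \<Rightarrow> 'o \<Rightarrow> 'o \<Rightarrow> 'o \<Rightarrow> 'm \<Rightarrow> 'm \<Rightarrow> bool" where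
  "is_orth_sum C a b c i j \<longleftrightarrow> is_biproduct C a b c i j (i\<^sup>\<dagger>) (j\<^sup>\<dagger>)"
  for C (structure)

locale unitary_multitensor_category =
  semisimple_category C + locally_finite_category C + linear_monoidal_category C
  for C :: "('o, 'm::ab_group_add) mcat" (structure) +
  assumes left_dual_exists: "c \<in> Obj C \<Longrightarrow> \<exists>d e k. is_dual C c d e k"
    and right_dual_exists: "c \<in> Obj C \<Longrightarrow> \<exists>d\<in>Obj C. \<exists>e k. is_dual C d c e k"
    and dag_hom: "\<lbrakk>a \<in> Obj C; b \<in> Obj C; f \<in> Hom C a b\<rbrakk> \<Longrightarrow> f\<^sup>\<dagger> \<in> Hom C b a"
    and dag_add: "\<lbrakk>a \<in> Obj C; b \<in> Obj C; f \<in> Hom C a b; g \<in> Hom C a b\<rbrakk>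
          \<Longrightarrow> (f + g)\<^sup>\<dagger> = f\<^sup>\<dagger> + g\<^sup>\<dagger>"
    and dag_scal: "\<lbrakk>a \<in> Obj C; b \<in> Obj C; f \<in> Hom C a b\<rbrakk>
          \<Longrightarrow> (scal C z f)\<^sup>\<dagger> = scal C (cnj z) (f\<^sup>\<dagger>)"
    and dag_dag: "\<lbrakk>a \<in> Obj C; b \<in> Obj C; f \<in> Hom C a b\<rbrakk> \<Longrightarrow> (f\<^sup>\<dagger>)\<^sup>\<dagger> = f"
    and dag_comp: "\<lbrakk>a \<in> Obj C; b \<in> Obj C; c \<in> Obj C; f \<in> Hom C b c; g \<in> Hom C a b\<rbrakk>
          \<Longrightarrow> (f \<cdot> g)\<^sup>\<dagger> = g\<^sup>\<dagger> \<cdot> f\<^sup>\<dagger>"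
    and dag_tens: "\<lbrakk>a \<in> Obj C; b \<in> Obj C; c \<in> Obj C; d \<in> Obj C; f \<in> Hom C a b; g \<in> Hom C c d\<rbrakk>
          \<Longrightarrow> (f \<otimes> g)\<^sup>\<dagger> = f\<^sup>\<dagger> \<otimes> g\<^sup>\<dagger>"
    and assoc_unitary: "\<lbrakk>a \<in> Obj C; b \<in> Obj C; c \<in> Obj C\<rbrakk>
          \<Longrightarrow> (Assoc C a b c)\<^sup>\<dagger> \<cdot> Assoc C a b c = Id C ((a \<odot> b) \<odot> c) \<and>
              Assoc C a b c \<cdot> (Assoc C a b c)\<^sup>\<dagger> = Id C (a \<odot> (b \<odot> c))"
    and lunit_unitary: "a \<in> Obj C
          \<Longrightarrow> (LUnit C a)\<^sup>\<dagger> \<cdot> LUnit C a = Id C (\<one> \<odot> a) \<and> LUnit C a \<cdot> (LUnit C a)\<^sup>\<dagger> = Id C a"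
    and runit_unitary: "a \<in> Obj C
          \<Longrightarrow> (RUnit C a)\<^sup>\<dagger> \<cdot> RUnit C a = Id C (a \<odot> \<one>) \<and> RUnit C a \<cdot> (RUnit C a)\<^sup>\<dagger> = Id C a"
    and cstar: "a \<in> Obj C \<Longrightarrow> cstar_endomorphisms C a"
    and orth_sum_exists: "\<lbrakk>a \<in> Obj C; b \<in> Obj C\<rbrakk> \<Longrightarrow> \<exists>c\<in>Obj C. \<exists>i j. is_orth_sum C a b c i j"
    and idempotents_split: "\<lbrakk>a \<in> Obj C; e \<in> Hom C a a; e \<cdot> e = e\<rbrakk>
          \<Longrightarrow> \<exists>b\<in>Obj C. \<exists>i\<in>Hom C b a. \<exists>p\<in>Hom C a b. p \<cdot> i = Id C b \<and> i \<cdot> p = e"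


section \<open>Gradings by the groupoid of matrix units\<close>

text \<open>
  The pair \<open>(i, j)\<close> is the matrix unit with indices \<open>i\<close> and \<open>j\<close>; \<open>(i, j)\<close> and \<open>(k, l)\<close> are
  composable iff \<open>j = k\<close>, and the product is then \<open>(i, l)\<close>.
\<close>

definition matrix_units :: "nat \<Rightarrow> (nat \<times> nat) set" where
  "matrix_units r = {1..r} \<times> {1..r}"

definition matrix_units_hom :: "nat \<Rightarrow> (nat \<times> nat \<Rightarrow> real) \<Rightarrow> bool" where
  "matrix_units_hom r \<pi> \<longleftrightarrow>
     (\<forall>g\<in>matrix_units r. 0 < \<pi> g) \<and>
     (\<forall>i\<in>{1..r}. \<pi> (i, i) = 1) \<and>
     (\<forall>i\<in>{1..r}. \<forall>j\<in>{1..r}. \<forall>k\<in>{1..r}. \<pi> (i, j) * \<pi> (j, k) = \<pi> (i, k))"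

text \<open>\<open>c\<close> is the orthogonal direct sum of objects \<open>x g\<close> of \<open>G g\<close>, with isometric inclusions \<open>v g\<close>.\<close>

definition is_decomposition ::
  "('o, 'm::ab_group_add) mcat \<Rightarrow> nat \<Rightarrow> (nat \<times> nat \<Rightarrow> 'o set) \<Rightarrow> 'o \<Rightarrow>
     (nat \<times> nat \<Rightarrow> 'o) \<Rightarrow> (nat \<times> nat \<Rightarrow> 'm) \<Rightarrow> bool" where
  "is_decomposition C r G c x v \<longleftrightarrow>
     (\<forall>g\<in>matrix_units r. x g \<in> G g \<and> v g \<in> Hom C (x g) c) \<and>
     (\<forall>g\<in>matrix_units r. \<forall>h\<in>matrix_units r.
        (v g)\<^sup>\<dagger> \<cdot> v h = (if g = h then Id C (x g) else 0)) \<and>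
     (\<Sum>g\<in>matrix_units r. v g \<cdot> (v g)\<^sup>\<dagger>) = Id C c"
  for C (structure)

text \<open>
  The subcategories of the grading are full and closed under isomorphism, so that each is given
  by its set \<open>G g\<close> of objects; it is a semisimple C*-category in its own right because it contains
  the zero objects and is closed under direct sums and direct summands.
\<close>

locale matrix_unit_grading =
  fixes C :: "('o, 'm::ab_group_add) mcat" (structure)
    and r :: nat
    and G :: "nat \<times> nat \<Rightarrow> 'o set"
  assumes grade_obj: "g \<in> matrix_units r \<Longrightarrow> G g \<subseteq> Obj C"
    and grade_zero: "\<lbrakk>g \<in> matrix_units r; is_zero_obj C z\<rbrakk> \<Longrightarrow> z \<in> G g"
    and grade_sum: "\<lbrakk>g \<in> matrix_units r; a \<in> G g; b \<in> G g; c \<in> Obj C;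
          is_biproduct C a b c u v p q\<rbrakk> \<Longrightarrow> c \<in> G g"
    and grade_summand: "\<lbrakk>g \<in> matrix_units r; a \<in> G g; b \<in> Obj C;
          u \<in> Hom C b a; p \<in> Hom C a b; p \<cdot> u = Id C b\<rbrakk> \<Longrightarrow> b \<in> G g"
    and grade_orthogonal: "\<lbrakk>g \<in> matrix_units r; h \<in> matrix_units r; g \<noteq> h; a \<in> G g; b \<in> G h\<rbrakk>
          \<Longrightarrow> Hom C a b = {0}"
    and grade_decomposition: "c \<in> Obj C \<Longrightarrow> \<exists>x v. is_decomposition C r G c x v"
    and grade_tens: "\<lbrakk>(i, j) \<in> matrix_units r; (j, k) \<in> matrix_units r; a \<in> G (i, j); b \<in> G (j, k)\<rbrakk>
          \<Longrightarrow> a \<odot> b \<in> G (i, k)"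
    and grade_tens_zero: "\<lbrakk>(i, j) \<in> matrix_units r; (k, l) \<in> matrix_units r; j \<noteq> k;
          a \<in> G (i, j); b \<in> G (k, l)\<rbrakk> \<Longrightarrow> is_zero_obj C (a \<odot> b)"

locale faithful_matrix_unit_grading = matrix_unit_grading C r G
  for C :: "('o, 'm::ab_group_add) mcat" (structure) and r G +
  assumes faithful: "g \<in> matrix_units r \<Longrightarrow> \<exists>a\<in>G g. \<not> is_zero_obj C a"

text \<open>
  The \<open>g\<close>-graded component of \<open>f : c \<rightarrow> c\<close>, as an endomorphism of \<open>c\<close>.  As there are no nonzero
  morphisms between different grades, \<open>v g \<cdot> (v g)\<^sup>\<dagger>\<close> is the same for all decompositions of \<open>c\<close>,
  and the choice below is immaterial.
\<close>

definition graded_component ::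
  "('o, 'm::ab_group_add) mcat \<Rightarrow> nat \<Rightarrow> (nat \<times> nat \<Rightarrow> 'o set) \<Rightarrow> 'o \<Rightarrow> 'm \<Rightarrow> nat \<times> nat \<Rightarrow> 'm" where
  "graded_component C r G c f g =
     (let v = (SOME v. \<exists>x. is_decomposition C r G c x v)
      in v g \<cdot> (v g)\<^sup>\<dagger> \<cdot> f \<cdot> v g \<cdot> (v g)\<^sup>\<dagger>)"
  for C (structure)


section \<open>Unitary dual functors and traces\<close>

record ('o, 'm) dual_data =
  dual :: "'o \<Rightarrow> 'o"
  ev   :: "'o \<Rightarrow> 'm"
  coev :: "'o \<Rightarrow> 'm"

text \<open>The dual \<open>dual b \<rightarrow> dual a\<close> of a morphism \<open>f : a \<rightarrow> b\<close>.\<close>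

definition dual_mor :: "('o, 'm) mcat \<Rightarrow> ('o, 'm) dual_data \<Rightarrow> 'o \<Rightarrow> 'o \<Rightarrow> 'm \<Rightarrow> 'm" where
  "dual_mor C D a b f =
     LUnit C (dual D a) \<cdot> (ev D b \<otimes> Id C (dual D a)) \<cdot> (Assoc C (dual D b) b (dual D a))\<^sup>\<dagger>
       \<cdot> (Id C (dual D b) \<otimes> (f \<otimes> Id C (dual D a))) \<cdot> (Id C (dual D b) \<otimes> coev D a)
       \<cdot> (RUnit C (dual D b))\<^sup>\<dagger>"
  for C (structure)

text \<open>The nested evaluation \<open>(dual b \<odot> dual a) \<odot> (a \<odot> b) \<rightarrow> \<one>\<close>.\<close>

definition nested_ev :: "('o, 'm) mcat \<Rightarrow> ('o, 'm) dual_data \<Rightarrow> 'o \<Rightarrow> 'o \<Rightarrow> 'm" where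
  "nested_ev C D a b =
     ev D b \<cdot> (Id C (dual D b) \<otimes> LUnit C b) \<cdot> (Id C (dual D b) \<otimes> (ev D a \<otimes> Id C b))
       \<cdot> (Id C (dual D b) \<otimes> (Assoc C (dual D a) a b)\<^sup>\<dagger>) \<cdot> Assoc C (dual D b) (dual D a) (a \<odot> b)"
  for C (structure)

text \<open>The canonical tensorator \<open>dual b \<odot> dual a \<rightarrow> dual (a \<odot> b)\<close>.\<close>

definition tensorator :: "('o, 'm) mcat \<Rightarrow> ('o, 'm) dual_data \<Rightarrow> 'o \<Rightarrow> 'o \<Rightarrow> 'm" where
  "tensorator C D a b =
     LUnit C (dual D (a \<odot> b)) \<cdot> (nested_ev C D a b \<otimes> Id C (dual D (a \<odot> b)))
       \<cdot> (Assoc C (dual D b \<odot> dual D a) (a \<odot> b) (dual D (a \<odot> b)))\<^sup>\<dagger>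
       \<cdot> (Id C (dual D b \<odot> dual D a) \<otimes> coev D (a \<odot> b)) \<cdot> (RUnit C (dual D b \<odot> dual D a))\<^sup>\<dagger>"
  for C (structure)

locale unitary_dual_functor =
  fixes C :: "('o, 'm) mcat" (structure) and D :: "('o, 'm) dual_data"
  assumes dual: "c \<in> Obj C \<Longrightarrow> is_dual C c (dual D c) (ev D c) (coev D c)"
    and dual_mor_dag: "\<lbrakk>a \<in> Obj C; b \<in> Obj C; f \<in> Hom C a b\<rbrakk>
          \<Longrightarrow> (dual_mor C D a b f)\<^sup>\<dagger> = dual_mor C D b a (f\<^sup>\<dagger>)"
    and tensorator_unitary: "\<lbrakk>a \<in> Obj C; b \<in> Obj C\<rbrakk>
          \<Longrightarrow> (tensorator C D a b)\<^sup>\<dagger> \<cdot> tensorator C D a b = Id C (dual D b \<odot> dual D a) \<and>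
              tensorator C D a b \<cdot> (tensorator C D a b)\<^sup>\<dagger> = Id C (dual D (a \<odot> b))"

definition tr_L :: "('o, 'm) mcat \<Rightarrow> ('o, 'm) dual_data \<Rightarrow> 'o \<Rightarrow> 'm \<Rightarrow> 'm" where
  "tr_L C D c f = ev D c \<cdot> (Id C (dual D c) \<otimes> f) \<cdot> (ev D c)\<^sup>\<dagger>"
  for C (structure)

definition tr_R :: "('o, 'm) mcat \<Rightarrow> ('o, 'm) dual_data \<Rightarrow> 'o \<Rightarrow> 'm \<Rightarrow> 'm" where
  "tr_R C D c f = (coev D c)\<^sup>\<dagger> \<cdot> (f \<otimes> Id C (dual D c)) \<cdot> coev D c"
  for C (structure)

text \<open>
  Linear functionals on the endomorphisms of the unit object are made undefined outside of that
  space, so that two of them are equal iff they agree there.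
\<close>

definition linear_functional :: "('o, 'm::ab_group_add) mcat \<Rightarrow> ('m \<Rightarrow> complex) \<Rightarrow> bool" where
  "linear_functional C \<psi> \<longleftrightarrow> \<psi> \<in> extensional (Hom C \<one> \<one>) \<and>
     (\<forall>f\<in>Hom C \<one> \<one>. \<forall>g\<in>Hom C \<one> \<one>. \<psi> (f + g) = \<psi> f + \<psi> g) \<and>
     (\<forall>z. \<forall>f\<in>Hom C \<one> \<one>. \<psi> (scal C z f) = z * \<psi> f)"
  for C (structure)

definition is_projection :: "('o, 'm) mcat \<Rightarrow> 'o \<Rightarrow> 'm \<Rightarrow> bool" where
  "is_projection C a p \<longleftrightarrow> p \<in> Hom C a a \<and> p \<cdot> p = p \<and> p\<^sup>\<dagger> = p"
  for C (structure)

definition is_minimal_projection :: "('o, 'm::ab_group_add) mcat \<Rightarrow> 'o \<Rightarrow> 'm \<Rightarrow> bool" where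
  "is_minimal_projection C a p \<longleftrightarrow> is_projection C a p \<and> p \<noteq> 0 \<and>
     (\<forall>q. is_projection C a q \<and> p \<cdot> q = q \<longrightarrow> q = 0 \<or> q = p)"
  for C (structure)

definition Psi :: "('o, 'm::ab_group_add) mcat \<Rightarrow> 'm \<Rightarrow> complex" where
  "Psi C = (THE \<Psi>. linear_functional C \<Psi> \<and> (\<forall>p. is_minimal_projection C \<one> p \<longrightarrow> \<Psi> p = 1))"
  for C (structure)

definition balanced_unitary_dual_functor ::
  "('o, 'm::ab_group_add) mcat \<Rightarrow> nat \<Rightarrow> (nat \<times> nat \<Rightarrow> 'o set) \<Rightarrow> (nat \<times> nat \<Rightarrow> real) \<Rightarrow>
     ('o, 'm) dual_data \<Rightarrow> bool" where
  "balanced_unitary_dual_functor C r G \<pi> D \<longleftrightarrow> unitary_dual_functor C D \<and>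
     (\<forall>c\<in>Obj C. \<forall>f\<in>Hom C c c. \<forall>g\<in>matrix_units r.
        Psi C (tr_L C D c (graded_component C r G c f g)) =
          of_real (\<pi> g) * Psi C (tr_R C D c (graded_component C r G c f g)))"

definition faithful_state :: "('o, 'm::ab_group_add) mcat \<Rightarrow> ('m \<Rightarrow> complex) \<Rightarrow> bool" where
  "faithful_state C \<psi> \<longleftrightarrow> linear_functional C \<psi> \<and> \<psi> (Id C \<one>) = 1 \<and>
     (\<forall>p\<in>Hom C \<one> \<one>. p \<cdot> p = p \<and> p \<noteq> 0 \<longrightarrow> \<psi> p \<in> \<real> \<and> 0 < Re (\<psi> p))"
  for C (structure)

definition equalizes_traces ::
  "('o, 'm) mcat \<Rightarrow> ('o, 'm) dual_data \<Rightarrow> ('m \<Rightarrow> complex) \<Rightarrow> bool" where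
  "equalizes_traces C D \<psi> \<longleftrightarrow>
     (\<forall>c\<in>Obj C. \<forall>f\<in>Hom C c c. \<psi> (tr_L C D c f) = \<psi> (tr_R C D c f))"

end

theory Submission
  imports Defs
begin

text \<open>
  Decompose the unit object along the grading. By faithfulness its diagonal components are
  nonzero, so they give \<open>r\<close> orthogonal projections \<open>P k\<close> in the \<open>r\<close>-dimensional algebra of
  endomorphisms of the unit, hence a basis. For \<open>f\<close> of grade \<open>(i, j)\<close> the tensor product rules
  of the grading force the left trace into the line of \<open>P j\<close> and the right trace into that of
  \<open>P i\<close>, and balancing says that their coefficients have ratio \<open>\<pi> (i, j)\<close>. So a
  functional \<open>\<psi>\<close> equalizes the traces as soon as \<open>\<psi> (P i) = \<pi> (i, j) * \<psi> (P j)\<close>; conversely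
  the identity of a nonzero object of grade \<open>(i, j)\<close> has nonzero right trace and forces this
  relation. It has exactly one normalized solution, \<open>\<psi> (P k)\<close> proportional to \<open>\<pi> (k, 1)\<close>.
\<close>

section \<open>Composition with zero and with finite sums\<close>

context linear_category
begin

lemma zero_hom: "a \<in> Obj C \<Longrightarrow> b \<in> Obj C \<Longrightarrow> 0 \<in> Hom C a b"
  using hom_subspace subspace_0 by blast

lemma sum_hom:
  "a \<in> Obj C \<Longrightarrow> b \<in> Obj C \<Longrightarrow> (\<And>s. s \<in> S \<Longrightarrow> f s \<in> Hom C a b) \<Longrightarrow> sum f S \<in> Hom C a b"
  using hom_subspace subspace_sum by blast

lemma comp_zero_left:
  assumes "a \<in> Obj C" "b \<in> Obj C" "c \<in> Obj C" "f \<in> Hom C a b"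
  shows "0 \<cdot> f = 0"
  using comp_add_left[OF assms(1-3) zero_hom[OF assms(2,3)] zero_hom[OF assms(2,3)] assms(4)]
  by simp

lemma comp_zero_right:
  assumes "a \<in> Obj C" "b \<in> Obj C" "c \<in> Obj C" "g \<in> Hom C b c"
  shows "g \<cdot> 0 = 0"
  using comp_add_right[OF assms(1-4) zero_hom[OF assms(1,2)] zero_hom[OF assms(1,2)]]
  by simp

lemma comp_sum_left:
  assumes o: "a \<in> Obj C" "b \<in> Obj C" "c \<in> Obj C" and f: "f \<in> Hom C a b"
    and g: "\<And>s. s \<in> S \<Longrightarrow> g s \<in> Hom C b c"
  shows "sum g S \<cdot> f = (\<Sum>s\<in>S. g s \<cdot> f)"
  using g
proof (induction S rule: infinite_finite_induct)
  case (insert s S)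
  then show ?case
    by (simp add: comp_add_left[OF o _ sum_hom[OF o(2,3)] f])
qed (simp_all add: comp_zero_left[OF o f])

lemma comp_sum_right:
  assumes o: "a \<in> Obj C" "b \<in> Obj C" "c \<in> Obj C" and g: "g \<in> Hom C b c"
    and f: "\<And>s. s \<in> S \<Longrightarrow> f s \<in> Hom C a b"
  shows "g \<cdot> sum f S = (\<Sum>s\<in>S. g \<cdot> f s)"
  using f
proof (induction S rule: infinite_finite_induct)
  case (insert s S)
  then show ?case
    by (simp add: comp_add_right[OF o g _ sum_hom[OF o(1,2)]])
qed (simp_all add: comp_zero_right[OF o g])

text \<open>Every morphism out of or into \<open>a\<close> is unchanged by composition with
  \<open>Id C a\<close>, hence vanishes together with it. This is how objects taken nonzero by
  faithfulness lead to contradictions.\<close>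

lemma is_zero_objI:
  assumes a: "a \<in> Obj C" and id: "Id C a = 0"
  shows "is_zero_obj C a"
  unfolding is_zero_obj_def
proof (intro conjI ballI equalityI subsetI)
  fix b f assume b: "b \<in> Obj C"
  { assume f: "f \<in> Hom C a b"
    show "f \<in> {0}"
      using comp_id_right[OF a b f] comp_zero_right[OF a a b f] id by simp }
  { assume f: "f \<in> Hom C b a"
    show "f \<in> {0}"
      using comp_id_left[OF b a f] comp_zero_left[OF b a a f] id by simp }
qed (use a zero_hom in auto)

end

section \<open>Tensor products with zero and with finite sums\<close>

context linear_monoidal_category
begin

lemma tens_zero_left:
  assumes "a \<in> Obj C" "b \<in> Obj C" "c \<in> Obj C" "d \<in> Obj C" "g \<in> Hom C c d"
  shows "0 \<otimes> g = 0"
  using tens_add_left[OF assms(1-4) zero_hom[OF assms(1,2)] zero_hom[OF assms(1,2)] assms(5)]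
  by simp

lemma tens_zero_right:
  assumes "a \<in> Obj C" "b \<in> Obj C" "c \<in> Obj C" "d \<in> Obj C" "f \<in> Hom C a b"
  shows "f \<otimes> 0 = 0"
  using tens_add_right[OF assms zero_hom[OF assms(3,4)] zero_hom[OF assms(3,4)]]
  by simp

lemma tens_sum_left:
  assumes o: "a \<in> Obj C" "b \<in> Obj C" "c \<in> Obj C" "d \<in> Obj C" and g: "g \<in> Hom C c d"
    and f: "\<And>s. s \<in> S \<Longrightarrow> f s \<in> Hom C a b"
  shows "sum f S \<otimes> g = (\<Sum>s\<in>S. f s \<otimes> g)"
  using f
proof (induction S rule: infinite_finite_induct)
  case (insert s S)
  then show ?case
    by (simp add: tens_add_left[OF o _ sum_hom[OF o(1,2)] g])
qed (simp_all add: tens_zero_left[OF o g])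

lemma tens_sum_right:
  assumes o: "a \<in> Obj C" "b \<in> Obj C" "c \<in> Obj C" "d \<in> Obj C" and f: "f \<in> Hom C a b"
    and g: "\<And>s. s \<in> S \<Longrightarrow> g s \<in> Hom C c d"
  shows "f \<otimes> sum g S = (\<Sum>s\<in>S. f \<otimes> g s)"
  using g
proof (induction S rule: infinite_finite_induct)
  case (insert s S)
  then show ?case
    by (simp add: tens_add_right[OF o f _ sum_hom[OF o(3,4)]])
qed (simp_all add: tens_zero_right[OF o f])

end

section \<open>Positivity of the dagger and nondegeneracy of duals\<close>

context unitary_multitensor_category
begin

text \<open>The C*-identity is only available for endomorphisms, so \<open>f\<close> is viewed as an
  off-diagonal corner of the endomorphism algebra of the orthogonal sum of \<open>a\<close> and \<open>b\<close>.\<close>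

lemma dag_comp_self_eq_zero:
  assumes a: "a \<in> Obj C" and b: "b \<in> Obj C" and f: "f \<in> Hom C a b" and 0: "f\<^sup>\<dagger> \<cdot> f = 0"
  shows "f = 0"
proof -
  obtain c i j where c: "c \<in> Obj C" and "is_orth_sum C a b c i j"
    using orth_sum_exists[OF a b] by blast
  then have i: "i \<in> Hom C a c" and j: "j \<in> Hom C b c"
    and i': "i\<^sup>\<dagger> \<in> Hom C c a" and j': "j\<^sup>\<dagger> \<in> Hom C c b"
    and ii: "i\<^sup>\<dagger> \<cdot> i = Id C a" and jj: "j\<^sup>\<dagger> \<cdot> j = Id C b"
    by (auto simp: is_orth_sum_def is_biproduct_def)
  have fi: "f \<cdot> i\<^sup>\<dagger> \<in> Hom C c b" by (rule comp_hom[OF c a b f i'])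
  define h where "h = j \<cdot> (f \<cdot> i\<^sup>\<dagger>)"
  have h: "h \<in> Hom C c c" unfolding h_def by (rule comp_hom[OF c b c j fi])
  have jh: "j\<^sup>\<dagger> \<cdot> h = f \<cdot> i\<^sup>\<dagger>"
    unfolding h_def by (simp add: comp_assoc[OF c b c b j' j fi, symmetric] jj comp_id_left[OF c b fi])
  have f': "f\<^sup>\<dagger> \<in> Hom C b a" by (rule dag_hom[OF a b f])
  have fi': "(f \<cdot> i\<^sup>\<dagger>)\<^sup>\<dagger> = i \<cdot> f\<^sup>\<dagger>"
    by (simp add: dag_comp[OF c a b f i'] dag_dag[OF a c i])
  have if': "i \<cdot> f\<^sup>\<dagger> \<in> Hom C b c" by (rule comp_hom[OF b a c i f'])
  have "h\<^sup>\<dagger> = (i \<cdot> f\<^sup>\<dagger>) \<cdot> j\<^sup>\<dagger>"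
    unfolding h_def by (simp add: dag_comp[OF c b c j fi] fi')
  then have "h\<^sup>\<dagger> \<cdot> h = (i \<cdot> f\<^sup>\<dagger>) \<cdot> (f \<cdot> i\<^sup>\<dagger>)"
    by (simp add: comp_assoc[OF c c b c if' j' h] jh)
  also have "\<dots> = i \<cdot> ((f\<^sup>\<dagger> \<cdot> f) \<cdot> i\<^sup>\<dagger>)"
    by (simp add: comp_assoc[OF c b a c i f' fi] comp_assoc[OF c a b a f' f i'])
  also have "\<dots> = 0"
    by (simp add: 0 comp_zero_left[OF c a a i'] comp_zero_right[OF c a c i])
  finally have "h\<^sup>\<dagger> \<cdot> h = 0" .
  then have "h = 0"
    using cstar[OF c] h zero_hom[OF c c] unfolding cstar_endomorphisms_def
    by (metis power2_eq_square mult_eq_0_iff)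
  then have "f \<cdot> i\<^sup>\<dagger> = 0" using jh comp_zero_right[OF c c b j'] by simp
  then have "f \<cdot> (i\<^sup>\<dagger> \<cdot> i) = 0"
    by (simp add: comp_assoc[OF a c a b f i' i, symmetric] comp_zero_left[OF a c b i])
  then show ?thesis by (simp add: ii comp_id_right[OF a b f])
qed

text \<open>The first zig-zag axiom writes \<open>Id C c\<close> as a composite containing
  \<open>k\<close>, so \<open>k = 0\<close> would make \<open>c\<close> a zero object.\<close>

lemma dual_coev_nonzero:
  assumes c: "c \<in> Obj C" and nz: "\<not> is_zero_obj C c" and "is_dual C c d e k"
  shows "k \<noteq> 0"
proof
  assume k0: "k = 0"
  have d: "d \<in> Obj C" and e: "e \<in> Hom C (d \<odot> c) \<one>"
    and zz: "RUnit C c \<cdot> (Id C c \<otimes> e) \<cdot> Assoc C c d c \<cdot> (0 \<otimes> Id C c) \<cdot> (LUnit C c)\<^sup>\<dagger> = Id C c"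
    using assms(3) k0 by (auto simp: is_dual_def)
  note cd = tens_obj[OF c d] and dc = tens_obj[OF d c] and cu = tens_obj[OF c unit_obj]
    and uc = tens_obj[OF unit_obj c]
  have A: "Assoc C c d c \<in> Hom C ((c \<odot> d) \<odot> c) (c \<odot> (d \<odot> c))"
    using assoc_iso[OF c d c] by (simp add: is_iso_def)
  have R: "RUnit C c \<in> Hom C (c \<odot> \<one>) c" using runit_iso[OF c] by (simp add: is_iso_def)
  have L: "(LUnit C c)\<^sup>\<dagger> \<in> Hom C c (\<one> \<odot> c)"
    using lunit_iso[OF c] dag_hom[OF uc c] by (simp add: is_iso_def)
  have E: "Id C c \<otimes> e \<in> Hom C (c \<odot> (d \<odot> c)) (c \<odot> \<one>)"
    by (rule tens_hom[OF c c dc unit_obj id_hom[OF c] e])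
  have M: "RUnit C c \<cdot> (Id C c \<otimes> e) \<cdot> Assoc C c d c \<in> Hom C ((c \<odot> d) \<odot> c) c"
    by (intro comp_hom[OF tens_obj[OF cd c] tens_obj[OF c dc] c _ A]
        comp_hom[OF tens_obj[OF c dc] cu c R E])
  have "0 \<otimes> Id C c = 0" by (rule tens_zero_left[OF unit_obj cd c c id_hom[OF c]])
  then have "Id C c = 0"
    using zz by (simp add: comp_zero_right[OF uc tens_obj[OF cd c] c M] comp_zero_left[OF c uc c L])
  then show False using is_zero_objI[OF c] nz by blast
qed

end

section \<open>Tensor products and the unit in a graded category\<close>

locale graded_multitensor_category =
  unitary_multitensor_category C + faithful_matrix_unit_grading C r G
  for C :: "('o, 'm::ab_group_add) mcat" (structure) and r G
begin

lemma grade_hom_zero: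
  assumes "g \<in> matrix_units r" "h \<in> matrix_units r" "g \<noteq> h" "a \<in> G g" "b \<in> G h" "f \<in> Hom C a b"
  shows "f = 0"
  using grade_orthogonal[OF assms(1-5)] assms(6) by blast

lemma decomposition_simps:
  assumes "is_decomposition C r G c x v" and c: "c \<in> Obj C" and g: "g \<in> matrix_units r"
  shows "x g \<in> G g" "x g \<in> Obj C" "v g \<in> Hom C (x g) c" "(v g)\<^sup>\<dagger> \<in> Hom C c (x g)"
    "v g \<cdot> (v g)\<^sup>\<dagger> \<in> Hom C c c"
proof -
  show 1: "x g \<in> G g" and 2: "v g \<in> Hom C (x g) c" using assms by (auto simp: is_decomposition_def)
  show 3: "x g \<in> Obj C" using 1 grade_obj[OF g] by blast
  show 4: "(v g)\<^sup>\<dagger> \<in> Hom C c (x g)" by (rule dag_hom[OF 3 c 2])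
  show "v g \<cdot> (v g)\<^sup>\<dagger> \<in> Hom C c c" by (rule comp_hom[OF c 3 c 2 4])
qed

lemma decomposition_orth:
  assumes "is_decomposition C r G c x v" "g \<in> matrix_units r" "h \<in> matrix_units r"
  shows "(v g)\<^sup>\<dagger> \<cdot> v h = (if g = h then Id C (x g) else 0)"
  using assms by (auto simp: is_decomposition_def)

lemma decomposition_sum:
  "is_decomposition C r G c x v \<Longrightarrow> (\<Sum>g\<in>matrix_units r. v g \<cdot> (v g)\<^sup>\<dagger>) = Id C c"
  by (auto simp: is_decomposition_def)

text \<open>The identity of \<open>d \<odot> a\<close> is the sum of the endomorphisms
  \<open>(v h \<cdot> (v h)\<^sup>\<dagger>) \<otimes> Id C a\<close>, so a morphism out of
  \<open>d \<odot> a\<close> is determined by its restrictions to the summands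
  \<open>x h \<odot> a\<close>. This reduces questions about an arbitrary \<open>d\<close> to
  homogeneous objects.\<close>

lemma decomposition_hom_zero_tens_left:
  assumes "is_decomposition C r G d x v" and a: "a \<in> Obj C" and d: "d \<in> Obj C" and b: "b \<in> Obj C"
    and e: "e \<in> Hom C (d \<odot> a) b"
    and z: "\<And>h. h \<in> matrix_units r \<Longrightarrow> e \<cdot> (v h \<otimes> Id C a) = 0"
  shows "e = 0"
proof -
  note dec = decomposition_simps[OF assms(1) d] and da = tens_obj[OF d a] and ia = id_hom[OF a]
  have "e \<cdot> ((v h \<cdot> (v h)\<^sup>\<dagger>) \<otimes> Id C a) = 0" if h: "h \<in> matrix_units r" for h
  proof -
    note xa = tens_obj[OF dec(2)[OF h] a]
    have "(v h \<cdot> (v h)\<^sup>\<dagger>) \<otimes> (Id C a \<cdot> Id C a) = (v h \<otimes> Id C a) \<cdot> ((v h)\<^sup>\<dagger> \<otimes> Id C a)"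
      by (rule tens_comp[OF d dec(2)[OF h] d a a a dec(4)[OF h] dec(3)[OF h] ia ia])
    moreover have "v h \<otimes> Id C a \<in> Hom C (x h \<odot> a) (d \<odot> a)"
      by (rule tens_hom[OF dec(2)[OF h] d a a dec(3)[OF h] ia])
    moreover have *: "(v h)\<^sup>\<dagger> \<otimes> Id C a \<in> Hom C (d \<odot> a) (x h \<odot> a)"
      by (rule tens_hom[OF d dec(2)[OF h] a a dec(4)[OF h] ia])
    ultimately show ?thesis
      using comp_assoc[OF da xa da b e, of "v h \<otimes> Id C a" "(v h)\<^sup>\<dagger> \<otimes> Id C a"] z[OF h]
        comp_zero_left[OF da xa b *] by (simp add: comp_id_left[OF a a ia])
  qed
  then have "e \<cdot> (\<Sum>h\<in>matrix_units r. (v h \<cdot> (v h)\<^sup>\<dagger>) \<otimes> Id C a) = 0"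
    by (subst comp_sum_right[OF da da b e]) (auto intro: tens_hom[OF d d a a dec(5) ia])
  then have "e \<cdot> ((\<Sum>h\<in>matrix_units r. v h \<cdot> (v h)\<^sup>\<dagger>) \<otimes> Id C a) = 0"
    by (subst tens_sum_left[OF d d a a ia]) (auto intro: dec(5))
  then show ?thesis
    by (simp add: decomposition_sum[OF assms(1)] tens_id[OF d a] comp_id_right[OF da b e])
qed

text \<open>Mirror image of the previous reduction, with the decomposed factor on the right.\<close>

lemma decomposition_hom_zero_tens_right:
  assumes "is_decomposition C r G d x v" and a: "a \<in> Obj C" and d: "d \<in> Obj C" and b: "b \<in> Obj C"
    and e: "e \<in> Hom C (a \<odot> d) b"
    and z: "\<And>h. h \<in> matrix_units r \<Longrightarrow> e \<cdot> (Id C a \<otimes> v h) = 0"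
  shows "e = 0"
proof -
  note dec = decomposition_simps[OF assms(1) d] and ad = tens_obj[OF a d] and ia = id_hom[OF a]
  have "e \<cdot> (Id C a \<otimes> (v h \<cdot> (v h)\<^sup>\<dagger>)) = 0" if h: "h \<in> matrix_units r" for h
  proof -
    note ax = tens_obj[OF a dec(2)[OF h]]
    have "(Id C a \<cdot> Id C a) \<otimes> (v h \<cdot> (v h)\<^sup>\<dagger>) = (Id C a \<otimes> v h) \<cdot> (Id C a \<otimes> (v h)\<^sup>\<dagger>)"
      by (rule tens_comp[OF a a a d dec(2)[OF h] d ia ia dec(4)[OF h] dec(3)[OF h]])
    moreover have "Id C a \<otimes> v h \<in> Hom C (a \<odot> x h) (a \<odot> d)"
      by (rule tens_hom[OF a a dec(2)[OF h] d ia dec(3)[OF h]])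
    moreover have *: "Id C a \<otimes> (v h)\<^sup>\<dagger> \<in> Hom C (a \<odot> d) (a \<odot> x h)"
      by (rule tens_hom[OF a a d dec(2)[OF h] ia dec(4)[OF h]])
    ultimately show ?thesis
      using comp_assoc[OF ad ax ad b e, of "Id C a \<otimes> v h" "Id C a \<otimes> (v h)\<^sup>\<dagger>"] z[OF h]
        comp_zero_left[OF ad ax b *] by (simp add: comp_id_left[OF a a ia])
  qed
  then have "e \<cdot> (\<Sum>h\<in>matrix_units r. Id C a \<otimes> (v h \<cdot> (v h)\<^sup>\<dagger>)) = 0"
    by (subst comp_sum_right[OF ad ad b e]) (auto intro: tens_hom[OF a a d d ia dec(5)])
  then have "e \<cdot> (Id C a \<otimes> (\<Sum>h\<in>matrix_units r. v h \<cdot> (v h)\<^sup>\<dagger>)) = 0"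
    by (subst tens_sum_right[OF a a d d ia]) (auto intro: dec(5))
  then show ?thesis
    by (simp add: decomposition_sum[OF assms(1)] tens_id[OF a d] comp_id_right[OF ad b e])
qed

text \<open>Tensoring on the left cannot change the second index: each homogeneous summand of
  \<open>d \<odot> a\<close> is zero or has a grade \<open>(m, j)\<close>, and such a grade has no
  nonzero morphisms to the grade \<open>(k, l)\<close> when \<open>l \<noteq> j\<close>. Applied to
  evaluations, this locates left traces.\<close>

lemma hom_tens_left_zero:
  assumes ij: "(i, j) \<in> matrix_units r" and kl: "(k, l) \<in> matrix_units r" and "l \<noteq> j"
    and a: "a \<in> G (i, j)" and d: "d \<in> Obj C" and b: "b \<in> G (k, l)" and e: "e \<in> Hom C (d \<odot> a) b"
  shows "e = 0"
proof -
  obtain x v where dec: "is_decomposition C r G d x v" using grade_decomposition[OF d] by blast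
  have oa: "a \<in> Obj C" and ob: "b \<in> Obj C" using a b grade_obj ij kl by blast+
  show ?thesis
  proof (rule decomposition_hom_zero_tens_left[OF dec oa d ob e])
    fix h assume h: "h \<in> matrix_units r"
    obtain m n where mn: "h = (m, n)" by (cases h)
    note dc = decomposition_simps[OF dec d h]
    have ev: "e \<cdot> (v h \<otimes> Id C a) \<in> Hom C (x h \<odot> a) b"
      by (rule comp_hom[OF tens_obj[OF dc(2) oa] tens_obj[OF d oa] ob e
            tens_hom[OF dc(2) d oa oa dc(3) id_hom[OF oa]]])
    show "e \<cdot> (v h \<otimes> Id C a) = 0"
    proof (cases "n = i")
      case True
      then have "x h \<odot> a \<in> G (m, j)" using grade_tens[of m i j] dc(1) a h ij mn by auto
      moreover have "(m, j) \<in> matrix_units r" using h ij mn by (auto simp: matrix_units_def)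
      ultimately show ?thesis
        using grade_hom_zero[OF _ kl _ _ b ev] \<open>l \<noteq> j\<close> by auto
    next
      case False
      then have "is_zero_obj C (x h \<odot> a)"
        using grade_tens_zero[of m n i j "x h" a] dc(1) a h ij mn by auto
      then show ?thesis using ev ob by (auto simp: is_zero_obj_def)
    qed
  qed
qed

text \<open>Mirror image: tensoring on the right cannot change the first index. Applied to adjoints
  of coevaluations, this locates right traces.\<close>

lemma hom_tens_right_zero:
  assumes ij: "(i, j) \<in> matrix_units r" and kl: "(k, l) \<in> matrix_units r" and "k \<noteq> i"
    and a: "a \<in> G (i, j)" and d: "d \<in> Obj C" and b: "b \<in> G (k, l)" and e: "e \<in> Hom C (a \<odot> d) b"
  shows "e = 0"
proof -
  obtain x v where dec: "is_decomposition C r G d x v" using grade_decomposition[OF d] by blast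
  have oa: "a \<in> Obj C" and ob: "b \<in> Obj C" using a b grade_obj ij kl by blast+
  show ?thesis
  proof (rule decomposition_hom_zero_tens_right[OF dec oa d ob e])
    fix h assume h: "h \<in> matrix_units r"
    obtain m n where mn: "h = (m, n)" by (cases h)
    note dc = decomposition_simps[OF dec d h]
    have ev: "e \<cdot> (Id C a \<otimes> v h) \<in> Hom C (a \<odot> x h) b"
      by (rule comp_hom[OF tens_obj[OF oa dc(2)] tens_obj[OF oa d] ob e
            tens_hom[OF oa oa dc(2) d id_hom[OF oa] dc(3)]])
    show "e \<cdot> (Id C a \<otimes> v h) = 0"
    proof (cases "m = j")
      case True
      then have "a \<odot> x h \<in> G (i, n)" using grade_tens[of i j n] dc(1) a h ij mn by auto
      moreover have "(i, n) \<in> matrix_units r" using h ij mn by (auto simp: matrix_units_def)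
      ultimately show ?thesis
        using grade_hom_zero[OF _ kl _ _ b ev] \<open>k \<noteq> i\<close> by auto
    next
      case False
      then have "is_zero_obj C (a \<odot> x h)"
        using grade_tens_zero[of i j m n a "x h"] dc(1) a h ij mn by auto
      then show ?thesis using ev ob by (auto simp: is_zero_obj_def)
    qed
  qed
qed

text \<open>Test the left unitor on a nonzero \<open>a\<close> of grade \<open>(i, i)\<close>. On
  the summand \<open>x h \<odot> a\<close> with \<open>h = (k, l)\<close> it vanishes for
  \<open>k \<noteq> i\<close> because the first index is preserved, and for \<open>k = i\<close>,
  \<open>l \<noteq> i\<close> because the two grades are not composable. Only
  \<open>h = (i, i)\<close> remains, so \<open>v (i, i) = 0\<close> would make a unitary zero and
  \<open>a\<close> a zero object.\<close>

lemma unit_decomposition_diagonal_nonzero: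
  assumes dec: "is_decomposition C r G \<one> x v" and i: "i \<in> {1..r}"
  shows "v (i, i) \<noteq> 0"
proof
  assume v0: "v (i, i) = 0"
  have ii: "(i, i) \<in> matrix_units r" using i by (auto simp: matrix_units_def)
  obtain a where a: "a \<in> G (i, i)" and nz: "\<not> is_zero_obj C a" using faithful[OF ii] by blast
  have oa: "a \<in> Obj C" using a grade_obj[OF ii] by blast
  have L: "LUnit C a \<in> Hom C (\<one> \<odot> a) a" using lunit_iso[OF oa] by (simp add: is_iso_def)
  note ua = tens_obj[OF unit_obj oa]
  have "LUnit C a = 0"
  proof (rule decomposition_hom_zero_tens_left[OF dec oa unit_obj oa L])
    fix h assume h: "h \<in> matrix_units r"
    note dc = decomposition_simps[OF dec unit_obj h]
    have m: "LUnit C a \<cdot> (v h \<otimes> Id C a) \<in> Hom C (x h \<odot> a) a"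
      by (rule comp_hom[OF tens_obj[OF dc(2) oa] ua oa L
            tens_hom[OF dc(2) unit_obj oa oa dc(3) id_hom[OF oa]]])
    obtain k l where kl: "h = (k, l)" by (cases h)
    show "LUnit C a \<cdot> (v h \<otimes> Id C a) = 0"
    proof (cases "h = (i, i)")
      case True
      then show ?thesis
        using v0 by (simp add: tens_zero_left[OF dc(2) unit_obj oa oa id_hom[OF oa]]
            comp_zero_right[OF tens_obj[OF dc(2) oa] ua oa L])
    next
      case False
      show ?thesis
      proof (cases "k = i")
        case True
        with False kl h ii have "is_zero_obj C (x h \<odot> a)"
          using grade_tens_zero[of k l i i "x h" a] dc(1) a by auto
        then show ?thesis using m oa by (auto simp: is_zero_obj_def)
      next
        case False
        then show ?thesis using hom_tens_right_zero[of k l i i "x h" a a] h kl ii dc(1) a oa m by auto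
      qed
    qed
  qed
  then have "Id C a = 0"
    using lunit_unitary[OF oa] dag_hom[OF ua oa L] by (metis comp_zero_left[OF oa ua oa])
  then show False using is_zero_objI[OF oa] nz by blast
qed

section \<open>Graded components of endomorphisms\<close>

lemma graded_component_decomposition:
  assumes "c \<in> Obj C"
  obtains x v where "is_decomposition C r G c x v"
    "\<And>f g. graded_component C r G c f g = v g \<cdot> (v g)\<^sup>\<dagger> \<cdot> f \<cdot> v g \<cdot> (v g)\<^sup>\<dagger>"
proof -
  have "\<exists>v x. is_decomposition C r G c x v"
    using grade_decomposition[OF assms] by blast
  then have "\<exists>x. is_decomposition C r G c x (SOME v. \<exists>x. is_decomposition C r G c x v)"
    by (rule someI_ex)
  then show thesis using that by (auto simp: graded_component_def Let_def)
qed

text \<open>The only feature of the component needed for the trace computations is that it passes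
  through an object of grade \<open>g\<close>; the explicit formula is hidden behind
  \<open>u\<close> and \<open>w\<close>.\<close>

lemma graded_component_factor:
  assumes c: "c \<in> Obj C" and f: "f \<in> Hom C c c" and g: "g \<in> matrix_units r"
  obtains y u w where "y \<in> G g" "u \<in> Hom C y c" "w \<in> Hom C c y"
    "graded_component C r G c f g = u \<cdot> w"
proof -
  obtain x v where dec: "is_decomposition C r G c x v"
    and gc: "\<And>f g. graded_component C r G c f g = v g \<cdot> (v g)\<^sup>\<dagger> \<cdot> f \<cdot> v g \<cdot> (v g)\<^sup>\<dagger>"
    using graded_component_decomposition[OF c] by blast
  note dc = decomposition_simps[OF dec c g]
  note vf = comp_hom[OF c c dc(2) dc(4) f]
  note vfv = comp_hom[OF dc(2) c dc(2) vf dc(3)]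
  have "graded_component C r G c f g = v g \<cdot> (((v g)\<^sup>\<dagger> \<cdot> f \<cdot> v g) \<cdot> (v g)\<^sup>\<dagger>)"
    by (simp add: gc comp_assoc[OF c c dc(2) c dc(3) dc(4) f]
        comp_assoc[OF dc(2) c dc(2) c dc(3) vf dc(3)] comp_assoc[OF c dc(2) dc(2) c dc(3) vfv dc(4)])
  then show thesis
    using that[OF dc(1) dc(3) comp_hom[OF c dc(2) dc(2) vfv dc(4)]] by blast
qed

lemma graded_component_hom:
  assumes c: "c \<in> Obj C" and f: "f \<in> Hom C c c" and g: "g \<in> matrix_units r"
  shows "graded_component C r G c f g \<in> Hom C c c"
  using graded_component_factor[OF c f g] comp_hom[OF c _ c] grade_obj[OF g]
  by (metis subsetD)

text \<open>Since there are no nonzero morphisms between different grades, \<open>f\<close> is block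
  diagonal for the projections \<open>q g\<close>. Its components are therefore the
  \<open>q g \<cdot> f\<close>, and the \<open>q g\<close> sum to the identity.\<close>

lemma sum_graded_components:
  assumes c: "c \<in> Obj C" and f: "f \<in> Hom C c c"
  shows "(\<Sum>g\<in>matrix_units r. graded_component C r G c f g) = f"
proof -
  obtain x v where dec: "is_decomposition C r G c x v"
    and gc: "\<And>f g. graded_component C r G c f g = v g \<cdot> (v g)\<^sup>\<dagger> \<cdot> f \<cdot> v g \<cdot> (v g)\<^sup>\<dagger>"
    using graded_component_decomposition[OF c] by blast
  define q where "q g = v g \<cdot> (v g)\<^sup>\<dagger>" for g
  note dc = decomposition_simps[OF dec c]
  have q: "q g \<in> Hom C c c" if "g \<in> matrix_units r" for g using dc(5)[OF that] by (simp add: q_def)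
  have qf: "q g \<cdot> f \<in> Hom C c c" if "g \<in> matrix_units r" for g by (rule comp_hom[OF c c c q[OF that] f])
  have fin: "finite (matrix_units r)" by (simp add: matrix_units_def)
  have q1: "(\<Sum>g\<in>matrix_units r. q g) = Id C c" using decomposition_sum[OF dec] by (simp add: q_def)
  \<comment> \<open>The middle factor \<open>(v g)\<^sup>\<dagger> \<cdot> f \<cdot> v h\<close> is
    a morphism from grade \<open>h\<close> to grade \<open>g\<close>.\<close>
  have off: "q g \<cdot> f \<cdot> q h = 0" if g: "g \<in> matrix_units r" and h: "h \<in> matrix_units r" and "g \<noteq> h" for g h
  proof -
    note vf = comp_hom[OF c c dc(2)[OF g] dc(4)[OF g] f]
    have "(v g)\<^sup>\<dagger> \<cdot> f \<cdot> v h = 0"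
      by (rule grade_hom_zero[OF h g _ dc(1)[OF h] dc(1)[OF g]
            comp_hom[OF dc(2)[OF h] c dc(2)[OF g] vf dc(3)[OF h]]]) (use \<open>g \<noteq> h\<close> in auto)
    then have "(v g)\<^sup>\<dagger> \<cdot> f \<cdot> q h = 0"
      by (simp add: q_def comp_assoc[OF c dc(2)[OF h] c dc(2)[OF g] vf dc(3)[OF h] dc(4)[OF h], symmetric]
          comp_zero_left[OF c dc(2)[OF h] dc(2)[OF g] dc(4)[OF h]])
    moreover have "q g \<cdot> f \<cdot> q h = v g \<cdot> ((v g)\<^sup>\<dagger> \<cdot> f \<cdot> q h)"
      unfolding q_def[of g]
      by (simp add: comp_assoc[OF c c dc(2)[OF g] c dc(3)[OF g] dc(4)[OF g] f]
          comp_assoc[OF c c dc(2)[OF g] c dc(3)[OF g] vf q[OF h]])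
    ultimately show ?thesis by (simp add: comp_zero_right[OF c dc(2)[OF g] c dc(3)[OF g]])
  qed
  \<comment> \<open>Inserting the identity as the sum of the \<open>q h\<close> on the right leaves
    only the diagonal block.\<close>
  have comp: "graded_component C r G c f g = q g \<cdot> f" if g: "g \<in> matrix_units r" for g
  proof -
    have "q g \<cdot> f = q g \<cdot> f \<cdot> (\<Sum>h\<in>matrix_units r. q h)"
      by (simp add: q1 comp_id_right[OF c c qf[OF g]])
    also have "\<dots> = (\<Sum>h\<in>matrix_units r. q g \<cdot> f \<cdot> q h)"
      by (rule comp_sum_right[OF c c c qf[OF g] q])
    also have "\<dots> = q g \<cdot> f \<cdot> q g"
      using sum.remove[OF fin g, of "\<lambda>h. q g \<cdot> f \<cdot> q h"] off[OF g] by (auto intro!: sum.neutral)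
    finally show ?thesis
      by (simp add: gc q_def
          comp_assoc[OF c dc(2)[OF g] c c _ dc(3)[OF g] dc(4)[OF g]] qf[OF g, unfolded q_def])
  qed
  have "(\<Sum>g\<in>matrix_units r. q g \<cdot> f) = (\<Sum>g\<in>matrix_units r. q g) \<cdot> f"
    by (rule comp_sum_left[OF c c c f q, symmetric])
  then show ?thesis by (simp add: comp q1 comp_id_left[OF c c f])
qed

text \<open>Every other component factors through an object of a different grade and vanishes, so
  this one carries the whole sum. It makes the identity of a homogeneous object a usable test
  morphism.\<close>

lemma graded_component_id:
  assumes g: "g \<in> matrix_units r" and a: "a \<in> G g"
  shows "graded_component C r G a (Id C a) g = Id C a"
proof -
  have oa: "a \<in> Obj C" using a grade_obj[OF g] by blast
  have "graded_component C r G a (Id C a) h = 0" if h: "h \<in> matrix_units r" and "h \<noteq> g" for h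
  proof -
    obtain y u w where y: "y \<in> G h" and u: "u \<in> Hom C y a" and w: "w \<in> Hom C a y"
      and gc: "graded_component C r G a (Id C a) h = u \<cdot> w"
      using graded_component_factor[OF oa id_hom[OF oa] h] by blast
    have oy: "y \<in> Obj C" using y grade_obj[OF h] by blast
    have "u = 0" by (rule grade_hom_zero[OF h g that(2) y a u])
    then show ?thesis by (simp add: gc comp_zero_left[OF oa oy oa w])
  qed
  moreover have "finite (matrix_units r)" by (simp add: matrix_units_def)
  ultimately show ?thesis
    using sum_graded_components[OF oa id_hom[OF oa]] sum.remove[OF _ g, of "graded_component C r G a (Id C a)"]
    by (simp add: sum.neutral)
qed

end

section \<open>The endomorphism algebra of the unit object\<close>

locale graded_unit_decomposition = graded_multitensor_category C r G
  for C :: "('o, 'm::ab_group_add) mcat" (structure) and r G +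
  fixes X V
  assumes dec: "is_decomposition C r G \<one> X V"
    and dim_unit: "dim (Hom C \<one> \<one>) = r"
begin

text \<open>These turn out to be exactly the minimal projections of the endomorphism algebra of the
  unit; the grading supplies them already indexed by the objects of the groupoid.\<close>

definition P :: "nat \<Rightarrow> 'm" where "P k = V (k, k) \<cdot> (V (k, k))\<^sup>\<dagger>"

lemmas V_simps = decomposition_simps[OF dec unit_obj]

lemma diag_mem: "k \<in> {1..r} \<Longrightarrow> (k, k) \<in> matrix_units r"
  by (simp add: matrix_units_def)

lemma unit_proj_mult:
  assumes g: "g \<in> matrix_units r" and h: "h \<in> matrix_units r"
  shows "(V g \<cdot> (V g)\<^sup>\<dagger>) \<cdot> (V h \<cdot> (V h)\<^sup>\<dagger>) = (if g = h then V h \<cdot> (V h)\<^sup>\<dagger> else 0)"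
proof -
  note vg = V_simps[OF g] and vh = V_simps[OF h]
  have "(V g \<cdot> (V g)\<^sup>\<dagger>) \<cdot> (V h \<cdot> (V h)\<^sup>\<dagger>) = V g \<cdot> (((V g)\<^sup>\<dagger> \<cdot> V h) \<cdot> (V h)\<^sup>\<dagger>)"
    by (simp add: comp_assoc[OF unit_obj unit_obj vg(2) unit_obj vg(3) vg(4) vh(5)]
        comp_assoc[OF unit_obj vh(2) unit_obj vg(2) vg(4) vh(3) vh(4)])
  then show ?thesis
    by (auto simp: decomposition_orth[OF dec g h] comp_id_left[OF unit_obj vh(2) vh(4)]
        comp_zero_left[OF unit_obj vh(2) vg(2) vh(4)] comp_zero_right[OF unit_obj vg(2) unit_obj vg(3)])
qed

lemma P_hom: "k \<in> {1..r} \<Longrightarrow> P k \<in> Hom C \<one> \<one>"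
  unfolding P_def by (rule V_simps(5)[OF diag_mem])

lemma P_mult: "j \<in> {1..r} \<Longrightarrow> k \<in> {1..r} \<Longrightarrow> P j \<cdot> P k = (if j = k then P k else 0)"
  unfolding P_def using unit_proj_mult[OF diag_mem diag_mem] by simp

lemma P_dag: "k \<in> {1..r} \<Longrightarrow> (P k)\<^sup>\<dagger> = P k"
  using V_simps[OF diag_mem, of k]
  by (simp add: P_def dag_comp[of \<one> "X (k, k)" \<one>] dag_dag[of "X (k, k)" \<one>] unit_obj)

text \<open>The isometry \<open>V (k, k)\<close> satisfies
  \<open>V (k, k) = P k \<cdot> V (k, k)\<close>, so it would vanish along with
  \<open>P k\<close>.\<close>

lemma P_nonzero:
  assumes k: "k \<in> {1..r}" shows "P k \<noteq> 0"
proof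
  assume "P k = 0"
  note v = V_simps[OF diag_mem[OF k]]
  have "V (k, k) = V (k, k) \<cdot> ((V (k, k))\<^sup>\<dagger> \<cdot> V (k, k))"
    by (simp add: decomposition_orth[OF dec diag_mem[OF k] diag_mem[OF k]] comp_id_right[OF v(2) unit_obj v(3)])
  also have "\<dots> = P k \<cdot> V (k, k)"
    by (simp add: P_def comp_assoc[OF v(2) unit_obj v(2) unit_obj v(3) v(4) v(3)])
  also have "\<dots> = 0" by (simp add: \<open>P k = 0\<close> comp_zero_left[OF v(2) unit_obj unit_obj v(3)])
  finally show False using unit_decomposition_diagonal_nonzero[OF dec k] by simp
qed

lemma P_inj: "inj_on P {1..r}"
  using P_mult P_nonzero by (intro inj_onI) (metis)

text \<open>The endomorphisms annihilated by \<open>t\<close> on the left form a subspace. With all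
  indices but one as \<open>K\<close> this gives independence of the \<open>P k\<close>, with all
  indices the vanishing of the off-diagonal projections.\<close>

lemma comp_span_P_zero:
  assumes t: "t \<in> Hom C \<one> \<one>" and K: "K \<subseteq> {1..r}" and z: "\<And>k. k \<in> K \<Longrightarrow> t \<cdot> P k = 0"
    and x: "x \<in> span (P ` K)"
  shows "t \<cdot> x = 0"
proof -
  have "span (P ` K) \<subseteq> {x \<in> Hom C \<one> \<one>. t \<cdot> x = 0}"
  proof (rule span_minimal)
    show "subspace {x \<in> Hom C \<one> \<one>. t \<cdot> x = 0}"
      using hom_subspace[OF unit_obj unit_obj] comp_zero_right[OF unit_obj unit_obj unit_obj t]
        comp_add_right[OF unit_obj unit_obj unit_obj t] comp_scal_right[OF unit_obj unit_obj unit_obj t]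
      by (auto simp: subspace_def)
    show "P ` K \<subseteq> {x \<in> Hom C \<one> \<one>. t \<cdot> x = 0}" using K P_hom z by auto
  qed
  then show ?thesis using x by blast
qed

lemma P_independent: "independent (P ` {1..r})"
  unfolding dependent_def
proof clarify
  fix k assume k: "k \<in> {1..r}" and "P k \<in> span (P ` {1..r} - {P k})"
  moreover have "P ` {1..r} - {P k} = P ` ({1..r} - {k})"
    using k P_inj by (simp add: inj_on_image_set_diff[of P "{1..r}"])
  ultimately have "P k \<in> span (P ` ({1..r} - {k}))" by simp
  then have "P k \<cdot> P k = 0"
    by (rule comp_span_P_zero[OF P_hom[OF k] Diff_subset, rotated]) (use P_mult[OF k] in auto)
  then show False using P_mult[OF k k] P_nonzero[OF k] by simp
qed

text \<open>A vector outside the span would extend the \<open>r\<close> independent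
  \<open>P k\<close> to \<open>r + 1\<close> independent vectors in a space of dimension
  \<open>r\<close>.\<close>

lemma unit_end_span: "Hom C \<one> \<one> \<subseteq> span (P ` {1..r})"
proof
  fix t assume t: "t \<in> Hom C \<one> \<one>"
  obtain F where F: "finite F" "Hom C \<one> \<one> = span F"
    using hom_finite_dim[OF unit_obj unit_obj] by blast
  obtain B where B: "B \<subseteq> Hom C \<one> \<one>" "independent B" "Hom C \<one> \<one> \<subseteq> span B" "card B = r"
    using basis_exists[of "Hom C \<one> \<one>"] dim_unit by metis
  \<comment> \<open>The cardinality of an infinite set counts as 0, so finiteness of
    \<open>B\<close> is taken from the finite spanning set \<open>F\<close> and not from
    \<open>card B = r\<close>.\<close>
  have finB: "finite B" using independent_span_bound[OF F(1) B(2)] B(1) F(2) by blast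
  show "t \<in> span (P ` {1..r})"
  proof (rule ccontr)
    assume nt: "t \<notin> span (P ` {1..r})"
    then have "independent (insert t (P ` {1..r}))" by (rule independent_insertI[OF _ P_independent])
    moreover have "insert t (P ` {1..r}) \<subseteq> span B" using t P_hom B(3) by auto
    ultimately have "card (insert t (P ` {1..r})) \<le> r"
      using independent_span_bound[OF finB] B(4) by auto
    moreover have "t \<notin> P ` {1..r}" using nt span_base by blast
    ultimately show False using card_image[OF P_inj] by simp
  qed
qed

text \<open>Since the diagonal projections already span, there is no room for the off-diagonal ones.\<close>

lemma unit_proj_off_diagonal:
  assumes g: "g \<in> matrix_units r" and "fst g \<noteq> snd g"
  shows "V g \<cdot> (V g)\<^sup>\<dagger> = 0"
proof -
  have "(V g \<cdot> (V g)\<^sup>\<dagger>) \<cdot> (V g \<cdot> (V g)\<^sup>\<dagger>) = 0"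
  proof (rule comp_span_P_zero[OF V_simps(5)[OF g] subset_refl])
    show "V g \<cdot> (V g)\<^sup>\<dagger> \<in> span (P ` {1..r})" using unit_end_span V_simps(5)[OF g] by blast
    show "V g \<cdot> (V g)\<^sup>\<dagger> \<cdot> P k = 0" if "k \<in> {1..r}" for k
      unfolding P_def using unit_proj_mult[OF g diag_mem[OF that]] assms(2) by auto
  qed
  then show ?thesis using unit_proj_mult[OF g g] by simp
qed

lemma sum_P: "(\<Sum>k\<in>{1..r}. P k) = Id C \<one>"
proof -
  have "(\<Sum>g\<in>matrix_units r. V g \<cdot> (V g)\<^sup>\<dagger>) = (\<Sum>g\<in>(\<lambda>k. (k, k)) ` {1..r}. V g \<cdot> (V g)\<^sup>\<dagger>)"
    by (rule sum.mono_neutral_right) (auto simp: matrix_units_def intro!: unit_proj_off_diagonal)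
  also have "\<dots> = (\<Sum>k\<in>{1..r}. P k)"
    by (subst sum.reindex) (auto simp: inj_on_def P_def)
  finally show ?thesis using decomposition_sum[OF dec] by simp
qed

text \<open>The claim is linear in \<open>t\<close> and clear for each \<open>P j\<close> by
  orthogonality, and the \<open>P j\<close> span.\<close>

lemma P_comp_scal:
  assumes t: "t \<in> Hom C \<one> \<one>" and k: "k \<in> {1..r}"
  shows "\<exists>z. P k \<cdot> t = scal C z (P k)"
proof -
  have "span (P ` {1..r}) \<subseteq> {t \<in> Hom C \<one> \<one>. \<exists>z. P k \<cdot> t = scal C z (P k)}"
  proof (rule span_minimal)
    show "subspace {t \<in> Hom C \<one> \<one>. \<exists>z. P k \<cdot> t = scal C z (P k)}"
      using hom_subspace[OF unit_obj unit_obj] comp_zero_right[OF unit_obj unit_obj unit_obj P_hom[OF k]]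
        comp_add_right[OF unit_obj unit_obj unit_obj P_hom[OF k]]
        comp_scal_right[OF unit_obj unit_obj unit_obj P_hom[OF k]]
      by (auto simp: subspace_def simp flip: scale_left_distrib intro: exI[of _ 0])
    show "P ` {1..r} \<subseteq> {t \<in> Hom C \<one> \<one>. \<exists>z. P k \<cdot> t = scal C z (P k)}"
    proof clarify
      fix j assume j: "j \<in> {1..r}"
      have "P k \<cdot> P j = scal C (if k = j then 1 else 0) (P k)" using P_mult[OF k j] by simp
      then show "P j \<in> Hom C \<one> \<one> \<and> (\<exists>z. P k \<cdot> P j = scal C z (P k))" using P_hom[OF j] by blast
    qed
  qed
  then show ?thesis using unit_end_span t by blast
qed

text \<open>The coordinates in the basis of the \<open>P k\<close>. Reading them off by composition
  with \<open>P k\<close> makes each one multiplicative as well as linear, that is, a character of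
  the algebra; the choice is unique because \<open>P k\<close> is nonzero.\<close>

definition coef :: "nat \<Rightarrow> 'm \<Rightarrow> complex" where
  "coef k t = (SOME z. P k \<cdot> t = scal C z (P k))"

lemma P_comp:
  "t \<in> Hom C \<one> \<one> \<Longrightarrow> k \<in> {1..r} \<Longrightarrow> P k \<cdot> t = scal C (coef k t) (P k)"
  unfolding coef_def by (rule someI_ex) (rule P_comp_scal)

lemma coef_eqI:
  assumes "t \<in> Hom C \<one> \<one>" "k \<in> {1..r}" "P k \<cdot> t = scal C z (P k)"
  shows "coef k t = z"
  using P_comp[OF assms(1,2)] assms(3) P_nonzero[OF assms(2)] by (simp add: scale_right_imp_eq)

lemma unit_end_expansion:
  assumes t: "t \<in> Hom C \<one> \<one>" shows "t = (\<Sum>k\<in>{1..r}. scal C (coef k t) (P k))"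
proof -
  have "t = (\<Sum>k\<in>{1..r}. P k) \<cdot> t" by (simp only: sum_P comp_id_left[OF unit_obj unit_obj t])
  also have "\<dots> = (\<Sum>k\<in>{1..r}. P k \<cdot> t)" by (rule comp_sum_left[OF unit_obj unit_obj unit_obj t P_hom])
  finally show ?thesis using P_comp[OF t] by simp
qed

lemma coef_add:
  assumes "s \<in> Hom C \<one> \<one>" "t \<in> Hom C \<one> \<one>" "k \<in> {1..r}"
  shows "coef k (s + t) = coef k s + coef k t"
proof (rule coef_eqI[OF subspace_add[OF hom_subspace[OF unit_obj unit_obj] assms(1,2)] assms(3)])
  show "P k \<cdot> (s + t) = scal C (coef k s + coef k t) (P k)"
    using assms by (simp only: comp_add_right[OF unit_obj unit_obj unit_obj P_hom] P_comp scale_left_distrib)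
qed

lemma coef_scal:
  assumes "t \<in> Hom C \<one> \<one>" "k \<in> {1..r}"
  shows "coef k (scal C z t) = z * coef k t"
proof (rule coef_eqI[OF subspace_scale[OF hom_subspace[OF unit_obj unit_obj] assms(1)] assms(2)])
  show "P k \<cdot> scal C z t = scal C (z * coef k t) (P k)"
    using assms by (simp only: comp_scal_right[OF unit_obj unit_obj unit_obj P_hom] P_comp scale_scale)
qed

lemma coef_comp:
  assumes s: "s \<in> Hom C \<one> \<one>" and t: "t \<in> Hom C \<one> \<one>" and k: "k \<in> {1..r}"
  shows "coef k (s \<cdot> t) = coef k s * coef k t"
  by (rule coef_eqI)
    (use assms in \<open>auto simp: comp_hom[OF unit_obj unit_obj unit_obj s t] P_comp
      comp_assoc[OF unit_obj unit_obj unit_obj unit_obj P_hom[OF k] s t, symmetric]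
      comp_scal_left[OF unit_obj unit_obj unit_obj P_hom[OF k] t]\<close>)

lemma coef_P: "j \<in> {1..r} \<Longrightarrow> k \<in> {1..r} \<Longrightarrow> coef k (P j) = (if k = j then 1 else 0)"
  by (rule coef_eqI) (auto simp: P_hom P_mult)

lemma unit_end_eqI:
  assumes "s \<in> Hom C \<one> \<one>" "t \<in> Hom C \<one> \<one>" "\<And>k. k \<in> {1..r} \<Longrightarrow> coef k s = coef k t"
  shows "s = t"
  using unit_end_expansion[OF assms(1)] unit_end_expansion[OF assms(2)] assms(3) by simp

lemma unit_end_zeroI:
  assumes "t \<in> Hom C \<one> \<one>" "\<And>k. k \<in> {1..r} \<Longrightarrow> coef k t = 0"
  shows "t = 0"
  using unit_end_expansion[OF assms(1)] assms(2) by simp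

section \<open>Functionals and minimal projections on the unit\<close>

lemma linear_functional_sum:
  assumes \<psi>: "linear_functional C \<psi>" and f: "\<And>s. s \<in> S \<Longrightarrow> f s \<in> Hom C \<one> \<one>"
  shows "\<psi> (sum f S) = (\<Sum>s\<in>S. \<psi> (f s))"
proof -
  have "\<psi> (scal C 0 0) = 0 * \<psi> 0"
    using \<psi> zero_hom[OF unit_obj unit_obj] unfolding linear_functional_def by blast
  then have "\<psi> 0 = 0" by simp
  then show ?thesis
    using f
  proof (induction S rule: infinite_finite_induct)
    case (insert s S)
    then show ?case
      using \<psi> sum_hom[OF unit_obj unit_obj, of S f] by (simp add: linear_functional_def)
  qed auto
qed

lemma linear_functional_expansion:
  assumes \<psi>: "linear_functional C \<psi>" and t: "t \<in> Hom C \<one> \<one>"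
  shows "\<psi> t = (\<Sum>k\<in>{1..r}. coef k t * \<psi> (P k))"
proof -
  have "\<psi> t = \<psi> (\<Sum>k\<in>{1..r}. scal C (coef k t) (P k))" using unit_end_expansion[OF t] by simp
  also have "\<dots> = (\<Sum>k\<in>{1..r}. \<psi> (scal C (coef k t) (P k)))"
    by (rule linear_functional_sum[OF \<psi>])
      (use P_hom hom_subspace[OF unit_obj unit_obj] in \<open>auto simp: subspace_scale\<close>)
  also have "\<dots> = (\<Sum>k\<in>{1..r}. coef k t * \<psi> (P k))"
    using \<psi> P_hom by (intro sum.cong) (auto simp: linear_functional_def)
  finally show ?thesis .
qed

lemma linear_functional_eqI:
  assumes "linear_functional C \<phi>" "linear_functional C \<psi>" "\<And>k. k \<in> {1..r} \<Longrightarrow> \<phi> (P k) = \<psi> (P k)"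
  shows "\<phi> = \<psi>"
proof (rule extensionalityI)
  show "\<phi> \<in> extensional (Hom C \<one> \<one>)" "\<psi> \<in> extensional (Hom C \<one> \<one>)"
    using assms(1,2) by (auto simp: linear_functional_def)
  show "\<phi> t = \<psi> t" if "t \<in> Hom C \<one> \<one>" for t
    using that assms by (simp add: linear_functional_expansion)
qed

text \<open>The functional with prescribed values \<open>w k\<close> on the basis, restricted
  because \<open>linear_functional\<close> requires extensionality. Constant weight 1 gives
  \<open>Psi C\<close>; the state sought has weights proportional to
  \<open>\<pi> (k, 1)\<close>.\<close>

definition weighted :: "(nat \<Rightarrow> complex) \<Rightarrow> 'm \<Rightarrow> complex" where
  "weighted w = restrict (\<lambda>t. \<Sum>k\<in>{1..r}. w k * coef k t) (Hom C \<one> \<one>)"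

lemma weighted_linear: "linear_functional C (weighted w)"
  using hom_subspace[OF unit_obj unit_obj]
  by (auto simp: linear_functional_def weighted_def subspace_add subspace_scale coef_add coef_scal
      algebra_simps sum.distrib sum_distrib_left)

lemma weighted_P: "k \<in> {1..r} \<Longrightarrow> weighted w (P k) = w k"
  by (simp add: weighted_def P_hom coef_P if_distrib cong: if_cong)

lemma coef_idempotent:
  assumes "p \<in> Hom C \<one> \<one>" "p \<cdot> p = p" "k \<in> {1..r}"
  shows "coef k p = 0 \<or> coef k p = 1"
  using coef_comp[OF assms(1,1,3)] assms(2) by simp

text \<open>A projection below \<open>P k\<close> is a multiple of \<open>P k\<close>, and as an
  idempotent it has coordinate 0 or 1.\<close>

lemma P_minimal:
  assumes k: "k \<in> {1..r}" shows "is_minimal_projection C \<one> (P k)"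
  unfolding is_minimal_projection_def
proof (intro conjI allI impI)
  show "is_projection C \<one> (P k)"
    using k by (simp add: is_projection_def P_hom P_mult P_dag)
  show "P k \<noteq> 0" by (rule P_nonzero[OF k])
  fix q assume q: "is_projection C \<one> q \<and> P k \<cdot> q = q"
  then have "q = scal C (coef k q) (P k)" using P_comp[OF _ k, of q] by (simp add: is_projection_def)
  then show "q = 0 \<or> q = P k"
    using coef_idempotent[of q k] q k by (auto simp: is_projection_def)
qed

text \<open>A nonzero idempotent has some coordinate equal to 1 and so lies above the corresponding
  \<open>P k\<close>; minimality forces equality.\<close>

lemma minimal_projection_is_P:
  assumes p: "is_minimal_projection C \<one> p"
  obtains k where "k \<in> {1..r}" "p = P k"
proof -
  have ph: "p \<in> Hom C \<one> \<one>" and pp: "p \<cdot> p = p" and "p \<noteq> 0"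
    using p by (auto simp: is_minimal_projection_def is_projection_def)
  then obtain k where k: "k \<in> {1..r}" and "coef k p \<noteq> 0" using unit_end_zeroI by blast
  then have 1: "coef k p = 1" using coef_idempotent[OF ph pp] by blast
  have "p \<cdot> P k = P k"
    by (rule unit_end_eqI[OF comp_hom[OF unit_obj unit_obj unit_obj ph P_hom[OF k]] P_hom[OF k]])
      (use k 1 in \<open>simp add: coef_comp[OF ph P_hom[OF k]] coef_P\<close>)
  then have "P k = p"
    using p P_minimal[OF k] P_nonzero[OF k] unfolding is_minimal_projection_def by blast
  then show thesis using that k by blast
qed

text \<open>The minimal projections are exactly the \<open>P k\<close>, which span, so the
  description defining \<open>Psi\<close> is satisfied by one functional only.\<close>

lemma Psi_eq: "Psi C = weighted (\<lambda>_. 1)"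
  unfolding Psi_def
proof (rule the_equality)
  show "linear_functional C (weighted (\<lambda>_. 1)) \<and>
      (\<forall>p. is_minimal_projection C \<one> p \<longrightarrow> weighted (\<lambda>_. 1) p = 1)"
    using weighted_linear minimal_projection_is_P by (metis weighted_P)
  show "\<Psi> = weighted (\<lambda>_. 1)"
    if "linear_functional C \<Psi> \<and> (\<forall>p. is_minimal_projection C \<one> p \<longrightarrow> \<Psi> p = 1)" for \<Psi>
    using that P_minimal by (intro linear_functional_eqI) (auto simp: weighted_linear weighted_P)
qed

text \<open>The coordinates of a nonzero idempotent are 0 or 1 and not all 0, so its value is a
  nonempty sum of positive weights.\<close>

lemma faithful_state_weighted:
  fixes w :: "nat \<Rightarrow> real"
  assumes pos: "\<And>k. k \<in> {1..r} \<Longrightarrow> 0 < w k" and one: "(\<Sum>k\<in>{1..r}. w k) = 1"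
  shows "faithful_state C (weighted (\<lambda>k. of_real (w k)))"
  unfolding faithful_state_def
proof (intro conjI ballI impI)
  let ?\<psi> = "weighted (\<lambda>k. of_real (w k))"
  show lin: "linear_functional C ?\<psi>" by (rule weighted_linear)
  have "?\<psi> (Id C \<one>) = (\<Sum>k\<in>{1..r}. ?\<psi> (P k))"
    unfolding sum_P[symmetric] by (rule linear_functional_sum[OF lin P_hom])
  also have "\<dots> = of_real (\<Sum>k\<in>{1..r}. w k)" by (simp add: weighted_P)
  finally show "?\<psi> (Id C \<one>) = 1" by (simp only: one of_real_1)
  fix p assume p: "p \<in> Hom C \<one> \<one>" and "p \<cdot> p = p \<and> p \<noteq> 0"
  then have pp: "p \<cdot> p = p" and "p \<noteq> 0" by auto
  then obtain j where j: "j \<in> {1..r}" "coef j p \<noteq> 0" using p unit_end_zeroI by blast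
  have c: "coef k p = of_real (Re (coef k p)) \<and> 0 \<le> Re (coef k p)" if "k \<in> {1..r}" for k
    using coef_idempotent[OF p pp that] by auto
  have eq: "?\<psi> p = of_real (\<Sum>k\<in>{1..r}. w k * Re (coef k p))"
    using c p by (simp add: weighted_def)
  have "0 < (\<Sum>k\<in>{1..r}. w k * Re (coef k p))"
    using j c pos coef_idempotent[OF p pp, of j]
    by (intro sum_pos2[of _ j]) (auto simp: less_imp_le)
  then show "?\<psi> p \<in> \<real>" "0 < Re (?\<psi> p)" unfolding eq by auto
qed

text \<open>Composition with \<open>P k\<close> passes through
  \<open>(V (k, k))\<^sup>\<dagger> \<cdot> e\<close>, a morphism into an object of grade
  \<open>(k, k)\<close>. Vanishing results for the grading thus become vanishing of
  coordinates.\<close>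

lemma coef_unit_comp_zero:
  assumes k: "k \<in> {1..r}" and z: "z \<in> Obj C" and e: "e \<in> Hom C z \<one>" and s: "s \<in> Hom C \<one> z"
    and 0: "(V (k, k))\<^sup>\<dagger> \<cdot> e = 0"
  shows "coef k (e \<cdot> s) = 0"
proof (rule coef_eqI[OF comp_hom[OF unit_obj z unit_obj e s] k])
  note v = V_simps[OF diag_mem[OF k]]
  have "P k \<cdot> (e \<cdot> s) = V (k, k) \<cdot> (((V (k, k))\<^sup>\<dagger> \<cdot> e) \<cdot> s)"
    by (simp add: P_def comp_assoc[OF unit_obj z unit_obj v(2) v(4) e s]
        comp_assoc[OF unit_obj unit_obj v(2) unit_obj v(3) v(4) comp_hom[OF unit_obj z unit_obj e s]])
  then show "P k \<cdot> (e \<cdot> s) = scal C 0 (P k)"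
    by (simp add: 0 comp_zero_left[OF unit_obj z v(2) s] comp_zero_right[OF unit_obj v(2) unit_obj v(3)])
qed

end

section \<open>Traces of graded components\<close>

locale unitary_dual_graded = graded_unit_decomposition C r G X V
  for C :: "('o, 'm::ab_group_add) mcat" (structure) and r G X V +
  fixes D :: "('o, 'm) dual_data"
  assumes D: "unitary_dual_functor C D"
begin

lemma dual_simps:
  assumes "c \<in> Obj C"
  shows "dual D c \<in> Obj C" "ev D c \<in> Hom C (dual D c \<odot> c) \<one>" "coev D c \<in> Hom C \<one> (c \<odot> dual D c)"
    "(ev D c)\<^sup>\<dagger> \<in> Hom C \<one> (dual D c \<odot> c)" "(coev D c)\<^sup>\<dagger> \<in> Hom C (c \<odot> dual D c) \<one>"
proof -
  show 1: "dual D c \<in> Obj C" and 2: "ev D c \<in> Hom C (dual D c \<odot> c) \<one>"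
    and 3: "coev D c \<in> Hom C \<one> (c \<odot> dual D c)"
    using unitary_dual_functor.dual[OF D assms] by (auto simp: is_dual_def)
  show "(ev D c)\<^sup>\<dagger> \<in> Hom C \<one> (dual D c \<odot> c)"
    by (rule dag_hom[OF tens_obj[OF 1 assms] unit_obj 2])
  show "(coev D c)\<^sup>\<dagger> \<in> Hom C (c \<odot> dual D c) \<one>"
    by (rule dag_hom[OF unit_obj tens_obj[OF assms 1] 3])
qed

lemma tr_L_hom:
  assumes c: "c \<in> Obj C" and f: "f \<in> Hom C c c"
  shows "tr_L C D c f \<in> Hom C \<one> \<one>"
proof -
  note d = dual_simps[OF c] and dc = tens_obj[OF dual_simps(1)[OF c] c]
  show ?thesis unfolding tr_L_def
    by (rule comp_hom[OF unit_obj dc unit_obj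
          comp_hom[OF dc dc unit_obj d(2) tens_hom[OF d(1,1) c c id_hom[OF d(1)] f]] d(4)])
qed

lemma tr_R_hom:
  assumes c: "c \<in> Obj C" and f: "f \<in> Hom C c c"
  shows "tr_R C D c f \<in> Hom C \<one> \<one>"
proof -
  note d = dual_simps[OF c] and cd = tens_obj[OF c dual_simps(1)[OF c]]
  show ?thesis unfolding tr_R_def
    by (rule comp_hom[OF unit_obj cd unit_obj
          comp_hom[OF cd cd unit_obj d(5) tens_hom[OF c c d(1,1) f id_hom[OF d(1)]]] d(3)])
qed

lemma tr_L_sum:
  assumes c: "c \<in> Obj C" and f: "\<And>s. s \<in> S \<Longrightarrow> f s \<in> Hom C c c"
  shows "tr_L C D c (sum f S) = (\<Sum>s\<in>S. tr_L C D c (f s))"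
proof -
  note d = dual_simps[OF c] and dc = tens_obj[OF dual_simps(1)[OF c] c]
  have t: "Id C (dual D c) \<otimes> f s \<in> Hom C (dual D c \<odot> c) (dual D c \<odot> c)" if "s \<in> S" for s
    by (rule tens_hom[OF d(1,1) c c id_hom[OF d(1)] f[OF that]])
  show ?thesis unfolding tr_L_def
    by (simp add: tens_sum_right[OF d(1,1) c c id_hom[OF d(1)] f]
        comp_sum_right[OF dc dc unit_obj d(2) t]
        comp_sum_left[OF unit_obj dc unit_obj d(4) comp_hom[OF dc dc unit_obj d(2) t]])
qed

lemma tr_R_sum:
  assumes c: "c \<in> Obj C" and f: "\<And>s. s \<in> S \<Longrightarrow> f s \<in> Hom C c c"
  shows "tr_R C D c (sum f S) = (\<Sum>s\<in>S. tr_R C D c (f s))"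
proof -
  note d = dual_simps[OF c] and cd = tens_obj[OF c dual_simps(1)[OF c]]
  have t: "f s \<otimes> Id C (dual D c) \<in> Hom C (c \<odot> dual D c) (c \<odot> dual D c)" if "s \<in> S" for s
    by (rule tens_hom[OF c c d(1,1) f[OF that] id_hom[OF d(1)]])
  show ?thesis unfolding tr_R_def
    by (simp add: tens_sum_left[OF c c d(1,1) id_hom[OF d(1)] f]
        comp_sum_right[OF cd cd unit_obj d(5) t]
        comp_sum_left[OF unit_obj cd unit_obj d(3) comp_hom[OF cd cd unit_obj d(5) t]])
qed

text \<open>The component factors through some \<open>y\<close> of grade \<open>(i, j)\<close>, so
  the trace factors through \<open>dual D c \<odot> y\<close>. That object has no nonzero morphisms
  to the grade \<open>(k, k)\<close> unless \<open>k = j\<close>.\<close>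

lemma coef_tr_L_graded_component:
  assumes c: "c \<in> Obj C" and f: "f \<in> Hom C c c" and ij: "(i, j) \<in> matrix_units r"
    and k: "k \<in> {1..r}" and "k \<noteq> j"
  shows "coef k (tr_L C D c (graded_component C r G c f (i, j))) = 0"
proof -
  note d = dual_simps[OF c] and dc = tens_obj[OF dual_simps(1)[OF c] c]
  obtain y u w where y: "y \<in> G (i, j)" and u: "u \<in> Hom C y c" and w: "w \<in> Hom C c y"
    and gc: "graded_component C r G c f (i, j) = u \<cdot> w"
    using graded_component_factor[OF c f ij] by blast
  have oy: "y \<in> Obj C" using y grade_obj[OF ij] by blast
  note dy = tens_obj[OF d(1) oy] and id = id_hom[OF d(1)] and v = V_simps[OF diag_mem[OF k]]
  note tu = tens_hom[OF d(1,1) oy c id u] and tw = tens_hom[OF d(1,1) c oy id w]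
  note eu = comp_hom[OF dy dc unit_obj d(2) tu]
  have "Id C (dual D c) \<otimes> (u \<cdot> w) = (Id C (dual D c) \<otimes> u) \<cdot> (Id C (dual D c) \<otimes> w)"
    using tens_comp[OF d(1,1,1) c oy c id id w u] by (simp add: comp_id_left[OF d(1,1) id])
  then have "tr_L C D c (u \<cdot> w) =
      (ev D c \<cdot> (Id C (dual D c) \<otimes> u)) \<cdot> ((Id C (dual D c) \<otimes> w) \<cdot> (ev D c)\<^sup>\<dagger>)"
    unfolding tr_L_def
    by (simp add: comp_assoc[OF dc dy dc unit_obj d(2) tu tw, symmetric]
        comp_assoc[OF unit_obj dc dy unit_obj eu tw d(4)])
  moreover have "(V (k, k))\<^sup>\<dagger> \<cdot> (ev D c \<cdot> (Id C (dual D c) \<otimes> u)) = 0"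
    by (rule hom_tens_left_zero[OF ij diag_mem[OF k] \<open>k \<noteq> j\<close> y d(1) v(1)
          comp_hom[OF dy unit_obj v(2) v(4) eu]])
  ultimately show ?thesis
    using coef_unit_comp_zero[OF k dy eu comp_hom[OF unit_obj dc dy tw d(4)]] by (simp add: gc)
qed

text \<open>Here the trace factors through \<open>y \<odot> dual D c\<close>, where the first index
  \<open>i\<close> is the one preserved.\<close>

lemma coef_tr_R_graded_component:
  assumes c: "c \<in> Obj C" and f: "f \<in> Hom C c c" and ij: "(i, j) \<in> matrix_units r"
    and k: "k \<in> {1..r}" and "k \<noteq> i"
  shows "coef k (tr_R C D c (graded_component C r G c f (i, j))) = 0"
proof -
  note d = dual_simps[OF c] and cd = tens_obj[OF c dual_simps(1)[OF c]]
  obtain y u w where y: "y \<in> G (i, j)" and u: "u \<in> Hom C y c" and w: "w \<in> Hom C c y"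
    and gc: "graded_component C r G c f (i, j) = u \<cdot> w"
    using graded_component_factor[OF c f ij] by blast
  have oy: "y \<in> Obj C" using y grade_obj[OF ij] by blast
  note yd = tens_obj[OF oy d(1)] and id = id_hom[OF d(1)] and v = V_simps[OF diag_mem[OF k]]
  note tu = tens_hom[OF oy c d(1,1) u id] and tw = tens_hom[OF c oy d(1,1) w id]
  note eu = comp_hom[OF yd cd unit_obj d(5) tu]
  have "(u \<cdot> w) \<otimes> Id C (dual D c) = (u \<otimes> Id C (dual D c)) \<cdot> (w \<otimes> Id C (dual D c))"
    using tens_comp[OF c oy c d(1,1,1) w u id id] by (simp add: comp_id_left[OF d(1,1) id])
  then have "tr_R C D c (u \<cdot> w) =
      ((coev D c)\<^sup>\<dagger> \<cdot> (u \<otimes> Id C (dual D c))) \<cdot> ((w \<otimes> Id C (dual D c)) \<cdot> coev D c)"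
    unfolding tr_R_def
    by (simp add: comp_assoc[OF cd yd cd unit_obj d(5) tu tw, symmetric]
        comp_assoc[OF unit_obj cd yd unit_obj eu tw d(3)])
  moreover have "(V (k, k))\<^sup>\<dagger> \<cdot> ((coev D c)\<^sup>\<dagger> \<cdot> (u \<otimes> Id C (dual D c))) = 0"
    by (rule hom_tens_right_zero[OF ij diag_mem[OF k] \<open>k \<noteq> i\<close> y d(1) v(1)
          comp_hom[OF yd unit_obj v(2) v(4) eu]])
  ultimately show ?thesis
    using coef_unit_comp_zero[OF k yd eu comp_hom[OF unit_obj cd yd tw d(3)]] by (simp add: gc)
qed

text \<open>Only the coordinate at \<open>j\<close> survives, so every functional sees this trace
  through its value on \<open>P j\<close> alone.\<close>

lemma functional_tr_L_graded_component:
  assumes c: "c \<in> Obj C" and f: "f \<in> Hom C c c" and ij: "(i, j) \<in> matrix_units r"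
    and \<psi>: "linear_functional C \<psi>"
  defines "t \<equiv> tr_L C D c (graded_component C r G c f (i, j))"
  shows "\<psi> t = coef j t * \<psi> (P j)"
proof -
  have j: "j \<in> {1..r}" using ij by (simp add: matrix_units_def)
  have t: "t \<in> Hom C \<one> \<one>" unfolding t_def by (rule tr_L_hom[OF c graded_component_hom[OF c f ij]])
  have "coef k t = 0" if "k \<in> {1..r} - {j}" for k
    unfolding t_def using coef_tr_L_graded_component[OF c f ij] that by blast
  then show ?thesis
    using linear_functional_expansion[OF \<psi> t] sum.remove[OF _ j, of "\<lambda>k. coef k t * \<psi> (P k)"]
    by (metis (no_types, lifting) finite_atLeastAtMost mult_zero_left sum.neutral add.right_neutral)
qed

lemma functional_tr_R_graded_component:
  assumes c: "c \<in> Obj C" and f: "f \<in> Hom C c c" and ij: "(i, j) \<in> matrix_units r"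
    and \<psi>: "linear_functional C \<psi>"
  defines "t \<equiv> tr_R C D c (graded_component C r G c f (i, j))"
  shows "\<psi> t = coef i t * \<psi> (P i)"
proof -
  have i: "i \<in> {1..r}" using ij by (simp add: matrix_units_def)
  have t: "t \<in> Hom C \<one> \<one>" unfolding t_def by (rule tr_R_hom[OF c graded_component_hom[OF c f ij]])
  have "coef k t = 0" if "k \<in> {1..r} - {i}" for k
    unfolding t_def using coef_tr_R_graded_component[OF c f ij] that by blast
  then show ?thesis
    using linear_functional_expansion[OF \<psi> t] sum.remove[OF _ i, of "\<lambda>k. coef k t * \<psi> (P k)"]
    by (metis (no_types, lifting) finite_atLeastAtMost mult_zero_left sum.neutral add.right_neutral)
qed

text \<open>The trace equals \<open>(coev D c)\<^sup>\<dagger> \<cdot> coev D c\<close>, which is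
  nonzero by positivity of the dagger.\<close>

lemma tr_R_id_nonzero:
  assumes c: "c \<in> Obj C" and nz: "\<not> is_zero_obj C c"
  shows "tr_R C D c (Id C c) \<noteq> 0"
proof -
  note d = dual_simps[OF c] and cd = tens_obj[OF c dual_simps(1)[OF c]]
  have "tr_R C D c (Id C c) = (coev D c)\<^sup>\<dagger> \<cdot> coev D c"
    by (simp add: tr_R_def tens_id[OF c d(1)] comp_id_right[OF cd unit_obj d(5)])
  then show ?thesis
    using dag_comp_self_eq_zero[OF unit_obj cd d(3)]
      dual_coev_nonzero[OF c nz unitary_dual_functor.dual[OF D c]] by auto
qed

end

section \<open>Equality of traces under balancing\<close>

locale balanced_dual_graded = unitary_dual_graded C r G X V D
  for C :: "('o, 'm::ab_group_add) mcat" (structure) and r G X V D +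
  fixes \<pi>
  assumes balanced: "balanced_unitary_dual_functor C r G \<pi> D"
begin

text \<open>\<open>Psi C\<close> takes the value 1 on every \<open>P k\<close>, so it returns
  precisely the surviving coordinate of each trace, and balancing becomes a relation between these
  two numbers.\<close>

lemma coef_tr_balanced:
  assumes c: "c \<in> Obj C" and f: "f \<in> Hom C c c" and ij: "(i, j) \<in> matrix_units r"
  shows "coef j (tr_L C D c (graded_component C r G c f (i, j))) =
    of_real (\<pi> (i, j)) * coef i (tr_R C D c (graded_component C r G c f (i, j)))"
proof -
  have "i \<in> {1..r}" "j \<in> {1..r}" using ij by (auto simp: matrix_units_def)
  then have "Psi C (P i) = 1" "Psi C (P j) = 1" by (simp_all only: Psi_eq weighted_P)
  moreover have "linear_functional C (Psi C)" by (simp add: Psi_eq weighted_linear)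
  moreover have "Psi C (tr_L C D c (graded_component C r G c f (i, j))) =
      of_real (\<pi> (i, j)) * Psi C (tr_R C D c (graded_component C r G c f (i, j)))"
    using balanced c f ij by (simp add: balanced_unitary_dual_functor_def)
  ultimately show ?thesis
    using functional_tr_L_graded_component[OF c f ij, of "Psi C"]
      functional_tr_R_graded_component[OF c f ij, of "Psi C"] by simp
qed

text \<open>By additivity it suffices to compare on each component. If \<open>b\<close> is the
  coordinate at \<open>i\<close> of the right trace, the two sides are
  \<open>\<pi> (i, j) * b * \<psi> (P j)\<close> and \<open>b * \<psi> (P i)\<close>.\<close>

lemma equalizes_traces_if:
  assumes \<psi>: "linear_functional C \<psi>"
    and rel: "\<And>i j. (i, j) \<in> matrix_units r \<Longrightarrow> \<psi> (P i) = of_real (\<pi> (i, j)) * \<psi> (P j)"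
  shows "equalizes_traces C D \<psi>"
  unfolding equalizes_traces_def
proof (intro ballI)
  fix c f assume c: "c \<in> Obj C" and f: "f \<in> Hom C c c"
  let ?f = "graded_component C r G c f"
  note gh = graded_component_hom[OF c f]
  have "\<psi> (tr_L C D c (?f g)) = \<psi> (tr_R C D c (?f g))" if "g \<in> matrix_units r" for g
  proof -
    obtain i j where "g = (i, j)" by (cases g)
    with that have ij: "(i, j) \<in> matrix_units r" by simp
    show ?thesis unfolding \<open>g = (i, j)\<close>
      using functional_tr_L_graded_component[OF c f ij \<psi>] functional_tr_R_graded_component[OF c f ij \<psi>]
        coef_tr_balanced[OF c f ij] rel[OF ij] by simp
  qed
  then have "(\<Sum>g\<in>matrix_units r. \<psi> (tr_L C D c (?f g))) = (\<Sum>g\<in>matrix_units r. \<psi> (tr_R C D c (?f g)))"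
    by (rule sum.cong[OF refl])
  then have "\<psi> (tr_L C D c (\<Sum>g\<in>matrix_units r. ?f g)) = \<psi> (tr_R C D c (\<Sum>g\<in>matrix_units r. ?f g))"
    by (simp add: tr_L_sum[OF c gh] tr_R_sum[OF c gh] linear_functional_sum[OF \<psi>] tr_L_hom[OF c gh] tr_R_hom[OF c gh])
  then show "\<psi> (tr_L C D c f) = \<psi> (tr_R C D c f)" by (simp add: sum_graded_components[OF c f])
qed

text \<open>Faithfulness of the grading supplies a nonzero \<open>c\<close> of grade
  \<open>(i, j)\<close>; equality of the traces of its identity gives the relation up to a factor,
  which is cancelled.\<close>

lemma equalizes_traces_P:
  assumes \<psi>: "linear_functional C \<psi>" and eq: "equalizes_traces C D \<psi>" and ij: "(i, j) \<in> matrix_units r"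
  shows "\<psi> (P i) = of_real (\<pi> (i, j)) * \<psi> (P j)"
proof -
  obtain c where c: "c \<in> G (i, j)" and nz: "\<not> is_zero_obj C c" using faithful[OF ij] by blast
  have oc: "c \<in> Obj C" using c grade_obj[OF ij] by blast
  note id = id_hom[OF oc] and gid = graded_component_id[OF ij c]
  let ?b = "coef i (tr_R C D c (Id C c))"
  \<comment> \<open>The right trace of the identity is nonzero, and all its other coordinates
    vanish.\<close>
  have "?b \<noteq> 0"
    using unit_end_zeroI[OF tr_R_hom[OF oc id]] tr_R_id_nonzero[OF oc nz]
      coef_tr_R_graded_component[OF oc id ij] unfolding gid by metis
  moreover have "of_real (\<pi> (i, j)) * ?b * \<psi> (P j) = ?b * \<psi> (P i)"
    using functional_tr_L_graded_component[OF oc id ij \<psi>] functional_tr_R_graded_component[OF oc id ij \<psi>]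
      coef_tr_balanced[OF oc id ij] eq oc id unfolding gid equalizes_traces_def by metis
  ultimately show ?thesis by (simp add: mult.assoc mult.left_commute)
qed

end

text \<open>The state is chosen before \<open>D\<close>: it depends on \<open>\<pi>\<close> only and
  serves every balanced dual functor, while each single one of them already determines it.\<close>

theorem theoremD:
  fixes C :: "('o, 'm::ab_group_add) mcat"
    and r :: nat
    and G :: "nat \<times> nat \<Rightarrow> 'o set"
    and \<pi> :: "nat \<times> nat \<Rightarrow> real"
  assumes "unitary_multitensor_category C"
    and "1 \<le> r"
    and "vector_space.dim (scal C) (Hom C (tunit C) (tunit C)) = r"
    and "faithful_matrix_unit_grading C r G"
    and "matrix_units_hom r \<pi>"
  shows "\<exists>\<psi>. faithful_state C \<psi> \<and>
    (\<forall>D. balanced_unitary_dual_functor C r G \<pi> D \<longrightarrow>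
       equalizes_traces C D \<psi> \<and>
       (\<forall>\<psi>'. faithful_state C \<psi>' \<and> equalizes_traces C D \<psi>' \<longrightarrow> \<psi>' = \<psi>))"
proof -
  interpret unitary_multitensor_category C by (rule assms(1))
  interpret faithful_matrix_unit_grading C r G by (rule assms(4))
  interpret graded_multitensor_category C r G by unfold_locales
  obtain X V where "is_decomposition C r G (tunit C) X V"
    using grade_decomposition[OF unit_obj] by blast
  then interpret graded_unit_decomposition C r G X V
    using assms(3) by unfold_locales auto
  \<comment> \<open>The object 1, available since \<open>1 \<le> r\<close>, is the base point of the
    groupoid: \<open>\<pi> (k, 1)\<close> is a potential whose ratios recover \<open>\<pi>\<close>,
    and \<open>S\<close> normalizes it.\<close>
  define S where "S = (\<Sum>k\<in>{1..r}. \<pi> (k, 1))"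
  define w where "w k = \<pi> (k, 1) / S" for k
  have one: "1 \<in> {1..r}" using assms(2) by simp
  have pos: "0 < \<pi> (k, 1)" if "k \<in> {1..r}" for k
    using assms(5) that one by (auto simp: matrix_units_hom_def matrix_units_def)
  have S: "0 < S" unfolding S_def using one pos by (intro sum_pos) auto
  have w: "0 < w k" if "k \<in> {1..r}" for k using pos[OF that] S by (simp add: w_def)
  have w_sum: "(\<Sum>k\<in>{1..r}. w k) = 1"
    using S unfolding w_def sum_divide_distrib[symmetric] S_def[symmetric] by simp
  have w_rel: "w i = \<pi> (i, j) * w j" if "(i, j) \<in> matrix_units r" for i j
  proof -
    have "\<pi> (i, j) * \<pi> (j, 1) = \<pi> (i, 1)"
      using assms(5) that one by (auto simp: matrix_units_hom_def matrix_units_def)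
    then show ?thesis by (simp add: w_def)
  qed
  let ?\<psi> = "weighted (\<lambda>k. of_real (w k))"
  have lin: "linear_functional C ?\<psi>" by (rule weighted_linear)
  have "equalizes_traces C D ?\<psi> \<and> (\<forall>\<psi>'. faithful_state C \<psi>' \<and> equalizes_traces C D \<psi>' \<longrightarrow> \<psi>' = ?\<psi>)"
    if bal: "balanced_unitary_dual_functor C r G \<pi> D" for D
  proof -
    interpret unitary_dual_functor C D
      using bal unfolding balanced_unitary_dual_functor_def by (rule conjunct1)
    interpret balanced_dual_graded C r G X V D \<pi>
      using bal by unfold_locales
    have "equalizes_traces C D ?\<psi>"
    proof (rule equalizes_traces_if[OF lin])
      fix i j assume ij: "(i, j) \<in> matrix_units r"
      then have "i \<in> {1..r}" "j \<in> {1..r}" by (auto simp: matrix_units_def)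
      then show "?\<psi> (P i) = of_real (\<pi> (i, j)) * ?\<psi> (P j)"
        by (simp only: weighted_P w_rel[OF ij] of_real_mult)
    qed
    moreover have "\<psi>' = ?\<psi>" if fs: "faithful_state C \<psi>'" and eq: "equalizes_traces C D \<psi>'" for \<psi>'
    proof (rule linear_functional_eqI[OF _ lin])
      show lin': "linear_functional C \<psi>'" using fs by (simp add: faithful_state_def)
      have rel: "\<psi>' (P k) = of_real (\<pi> (k, 1)) * \<psi>' (P 1)" if "k \<in> {1..r}" for k
        by (rule equalizes_traces_P[OF lin' eq]) (use that one in \<open>auto simp: matrix_units_def\<close>)
      \<comment> \<open>The relations fix \<open>\<psi>'\<close> up to its value on
        \<open>P 1\<close>; normalization at the identity forces that value to be
        \<open>1 / S\<close>.\<close>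
      have "1 = \<psi>' (\<Sum>k\<in>{1..r}. P k)" unfolding sum_P using fs by (simp add: faithful_state_def)
      also have "\<dots> = (\<Sum>k\<in>{1..r}. \<psi>' (P k))" by (rule linear_functional_sum[OF lin' P_hom])
      also have "\<dots> = (\<Sum>k\<in>{1..r}. of_real (\<pi> (k, 1)) * \<psi>' (P 1))" by (rule sum.cong[OF refl rel])
      also have "\<dots> = of_real S * \<psi>' (P 1)" by (simp only: S_def of_real_sum sum_distrib_right)
      finally have "\<psi>' (P 1) = of_real (1 / S)" using S by (simp add: field_simps)
      then show "\<psi>' (P k) = ?\<psi> (P k)" if "k \<in> {1..r}" for k
        using rel[OF that] unfolding weighted_P[OF that] w_def by simp
    qed
    ultimately show ?thesis by blast
  qed
  then show ?thesis using faithful_state_weighted[OF w w_sum] by (intro exI[of _ ?\<psi>]) simp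
qed

end
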